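(* If $0<t\leq1$, $s>0$, $s+t>1$, $z\in\mathbf C^d$ and $$u=\sum_{\alpha\in\mathbf N^d}\frac{z^\alpha}{\alpha!}(-D)^\alpha\delta_0,$$ then $u\in(\Sigma_s^t)'(\mathbf R^d)$ and $$\mathrm{WF}^{s,t}(u)=\{0\}\times(\mathbf R^d\setminus0).$$
   Context: Notation: $\mathbf N=\{0,1,2,\dots\}$, $D^\beta=(-i)^{|\beta|}\partial^\beta$, $(-D)^\alpha=(-1)^{|\alpha|}D^\alpha$, $\delta_0$ is the Dirac distribution at $0$, $T^*\mathbf R^d\simeq\mathbf R^{2d}$. For $s,t>0$ with $s+t>1$, the (Beurling type) Gelfand--Shilov space $\Sigma_s^t(\mathbf R^d)$ consists of all $f\in C^\infty(\mathbf R^d)$ such that for every $h>0$ $$\sup_{\alpha,\beta\in\mathbf N^d,\,x\in\mathbf R^d}\frac{|x^\alpha D^\beta f(x)|}{h^{|\alpha+\beta|}\alpha!^s\beta!^t}<\infty$$ (lower index $s$: decay; upper index $t$: regularity), with the Fréchet topology given by these seminorms. $(\Sigma_s^t)'(\mathbf R^d)$ is its topological dual; the action $(u,\varphi)$ is conjugate linear in $\varphi$ and consistent with the $L^2$ inner product; in particular $(D^\alpha\delta_0,\varphi)=\overline{D^\alpha\varphi(0)}$. The series for $u$ is understood as convergent in $(\Sigma_s^t)'(\mathbf R^d)$. Short-time Fourier transform: with $T_xf(y)=f(y-x)$, $M_\xi f(y)=e^{i\langle y,\xi\rangle}f(y)$, set $V_\psi u(x,\xi)=(2\pi)^{-d/2}(u,M_\xi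 T_x\psi)$. Wave front set: for $u\in(\Sigma_s^t)'(\mathbf R^d)$ and a fixed $\psi\in\Sigma_s^t(\mathbf R^d)\setminus\{0\}$, $(x_0,\xi_0)\in T^*\mathbf R^d\setminus0$ satisfies $(x_0,\xi_0)\notin\mathrm{WF}^{s,t}(u)$ if there is an open set $U\subseteq T^*\mathbf R^d\setminus0$ containing $(x_0,\xi_0)$ such that $$\sup_{\lambda>0,\,(x,\xi)\in U}e^{r\lambda}|V_\psi u(\lambda^sx,\lambda^t\xi)|<\infty\quad\forall r>0.$$ The definition does not depend on the choice of $\psi$. *)

theory Defs
  imports "HOL-Analysis.Analysis"
begin

section \<open>Multi-indices and derivatives\<close>

type_synonym 'd multi_index = "nat ^ 'd"

definition mi_size :: "'d::finite multi_index \<Rightarrow> nat" where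
  "mi_size \<alpha> = (\<Sum>i\<in>UNIV. \<alpha> $ i)"

definition mi_fact :: "'d::finite multi_index \<Rightarrow> real" where
  "mi_fact \<alpha> = (\<Prod>i\<in>UNIV. fact (\<alpha> $ i))"

definition mi_power :: "('a::comm_ring_1) ^ 'd \<Rightarrow> 'd::finite multi_index \<Rightarrow> 'a" where
  "mi_power x \<alpha> = (\<Prod>i\<in>UNIV. (x $ i) ^ (\<alpha> $ i))"

definition partial_deriv :: "'d::finite \<Rightarrow> (real ^ 'd \<Rightarrow> complex) \<Rightarrow> real ^ 'd \<Rightarrow> complex" where
  "partial_deriv i f = (\<lambda>x. frechet_derivative f (at x) (axis i 1))"

text \<open>Differentiability of every iterated partial derivative makes all of them continuous,
  so this is the class of \<open>C\<^sup>\<infinity>\<close> functions.\<close>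

definition smooth :: "(real ^ 'd \<Rightarrow> complex) \<Rightarrow> bool" where
  "smooth f \<longleftrightarrow> (\<forall>is::'d::finite list. foldr partial_deriv is f differentiable_on UNIV)"

text \<open>The index type carries no order, so an order of differentiation is chosen arbitrarily;
  on smooth functions the choice is irrelevant, as partial derivatives commute.\<close>

definition mi_deriv ::
    "'d::finite multi_index \<Rightarrow> (real ^ 'd \<Rightarrow> complex) \<Rightarrow> real ^ 'd \<Rightarrow> complex" where
  "mi_deriv \<beta> f = foldr partial_deriv (SOME is. \<forall>i. count_list is i = \<beta> $ i) f"

definition D_op ::
    "'d::finite multi_index \<Rightarrow> (real ^ 'd \<Rightarrow> complex) \<Rightarrow> real ^ 'd \<Rightarrow> complex" where
  "D_op \<beta> f = (\<lambda>x. (- \<i>) ^ mi_size \<beta> * mi_deriv \<beta> f x)"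


section \<open>The Beurling type Gelfand--Shilov space\<close>

definition gs_quotient ::
    "real \<Rightarrow> real \<Rightarrow> real \<Rightarrow> (real ^ 'd \<Rightarrow> complex)
      \<Rightarrow> 'd::finite multi_index \<times> 'd multi_index \<times> (real ^ 'd) \<Rightarrow> real" where
  "gs_quotient s t h f = (\<lambda>(\<alpha>, \<beta>, x).
     cmod (of_real (mi_power x \<alpha>) * D_op \<beta> f x) /
     (h ^ mi_size (\<alpha> + \<beta>) * mi_fact \<alpha> powr s * mi_fact \<beta> powr t))"

definition gelfand_shilov :: "real \<Rightarrow> real \<Rightarrow> (real ^ 'd::finite \<Rightarrow> complex) set" where
  "gelfand_shilov s t = {f. smooth f \<and> (\<forall>h>0. bdd_above (range (gs_quotient s t h f)))}"

definition gs_seminorm :: "real \<Rightarrow> real \<Rightarrow> real \<Rightarrow> (real ^ 'd::finite \<Rightarrow> complex) \<Rightarrow> real" where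
  "gs_seminorm s t h f = (SUP p. gs_quotient s t h f p)"

definition gs_topology :: "real \<Rightarrow> real \<Rightarrow> (real ^ 'd::finite \<Rightarrow> complex) topology" where
  "gs_topology s t = topology_generated_by
     {{g \<in> gelfand_shilov s t. gs_seminorm s t h (\<lambda>x. g x - f x) < \<epsilon>} | f h \<epsilon>.
        f \<in> gelfand_shilov s t \<and> h > 0 \<and> \<epsilon> > 0}"

definition gs_bounded :: "real \<Rightarrow> real \<Rightarrow> (real ^ 'd::finite \<Rightarrow> complex) set \<Rightarrow> bool" where
  "gs_bounded s t B \<longleftrightarrow>
     B \<subseteq> gelfand_shilov s t \<and> (\<forall>h>0. bdd_above (gs_seminorm s t h ` B))"


section \<open>Ultradistributions\<close>

text \<open>The action \<open>(u, \<phi>)\<close> is application \<open>u \<phi>\<close>; it is conjugate linear in \<open>\<phi>\<close>.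
  Only the values of \<open>u\<close> on the Gelfand--Shilov space are relevant.\<close>

type_synonym 'd functional = "(real ^ 'd \<Rightarrow> complex) \<Rightarrow> complex"

definition gs_dual :: "real \<Rightarrow> real \<Rightarrow> 'd::finite functional set" where
  "gs_dual s t = {u.
     (\<forall>\<phi>\<in>gelfand_shilov s t. \<forall>\<eta>\<in>gelfand_shilov s t. u (\<lambda>x. \<phi> x + \<eta> x) = u \<phi> + u \<eta>) \<and>
     (\<forall>c. \<forall>\<phi>\<in>gelfand_shilov s t. u (\<lambda>x. c * \<phi> x) = cnj c * u \<phi>) \<and>
     continuous_map (gs_topology s t) euclidean u}"

text \<open>The strong dual topology (uniform convergence on bounded sets). The basic sets are written
  with an intermediate \<open>\<delta> < \<epsilon>\<close> so that they express that the supremum over \<open>B\<close> is \<open>< \<epsilon>\<close>,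
  also for empty \<open>B\<close>.\<close>

definition gs_dual_topology :: "real \<Rightarrow> real \<Rightarrow> 'd::finite functional topology" where
  "gs_dual_topology s t = topology_generated_by
     {{v \<in> gs_dual s t. \<exists>\<delta><\<epsilon>. \<forall>\<phi>\<in>B. cmod (v \<phi> - u \<phi>) \<le> \<delta>} | u B \<epsilon>.
        u \<in> gs_dual s t \<and> gs_bounded s t B \<and> \<epsilon> > 0}"

definition dirac :: "'d::finite functional" where
  "dirac = (\<lambda>\<phi>. cnj (\<phi> 0))"

text \<open>\<open>D\<^sup>\<alpha>\<close> is formally self-adjoint for the \<open>L\<^sup>2\<close> inner product, so
  \<open>(D\<^sup>\<alpha> u, \<phi>) = (u, D\<^sup>\<alpha> \<phi>)\<close> without a sign.\<close>

definition D_dist :: "'d::finite multi_index \<Rightarrow> 'd functional \<Rightarrow> 'd functional" where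
  "D_dist \<alpha> u = (\<lambda>\<phi>. u (D_op \<alpha> \<phi>))"

definition neg_D_dist :: "'d::finite multi_index \<Rightarrow> 'd functional \<Rightarrow> 'd functional" where
  "neg_D_dist \<alpha> u = (\<lambda>\<phi>. (- 1) ^ mi_size \<alpha> * D_dist \<alpha> u \<phi>)"


section \<open>Short-time Fourier transform and wave front set\<close>

definition translation :: "real ^ 'd::finite \<Rightarrow> (real ^ 'd \<Rightarrow> complex) \<Rightarrow> real ^ 'd \<Rightarrow> complex" where
  "translation x f = (\<lambda>y. f (y - x))"

definition modulation :: "real ^ 'd::finite \<Rightarrow> (real ^ 'd \<Rightarrow> complex) \<Rightarrow> real ^ 'd \<Rightarrow> complex" where
  "modulation \<xi> f = (\<lambda>y. exp (\<i> * of_real (y \<bullet> \<xi>)) * f y)"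

definition stft ::
    "(real ^ 'd \<Rightarrow> complex) \<Rightarrow> 'd::finite functional \<Rightarrow> real ^ 'd \<Rightarrow> real ^ 'd \<Rightarrow> complex" where
  "stft \<psi> u x \<xi> =
     of_real ((2 * pi) powr (- real CARD('d) / 2)) * u (modulation \<xi> (translation x \<psi>))"

definition wave_front_set ::
    "real \<Rightarrow> real \<Rightarrow> (real ^ 'd \<Rightarrow> complex) \<Rightarrow> 'd::finite functional
      \<Rightarrow> ((real ^ 'd) \<times> (real ^ 'd)) set" where
  "wave_front_set s t \<psi> u = {p. p \<noteq> 0 \<and> \<not> (\<exists>U. open U \<and> U \<subseteq> - {0} \<and> p \<in> U \<and>
     (\<forall>r>0. bdd_above {exp (r * \<mu>) * cmod (stft \<psi> u ((\<mu> powr s) *\<^sub>R x) ((\<mu> powr t) *\<^sub>R \<xi>)) | \<mu> x \<xi>.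
        \<mu> > 0 \<and> (x, \<xi>) \<in> U}))}"

end

theory Submission
  imports Defs
begin

text \<open>
  Let \<open>w = \<i> cnj z\<close> and let \<open>L\<close> be the derivation \<open>\<Sum>\<^sub>j w\<^sub>j \<partial>\<^sub>j\<close>. By the multinomial theorem the pairing of \<open>u\<close>
  with \<open>\<phi>\<close> is the conjugate of \<open>T \<phi> 0\<close>, where \<open>T = exp L\<close> is the shift by the complex vector \<open>w\<close>; since
  \<open>t \<le> 1\<close>, test functions are restrictions of entire functions and all series converge absolutely.
  As \<open>L\<close> is a derivation, \<open>T\<close> is multiplicative, hence \<open>\<bar>V\<^sub>\<psi> u(x, \<xi>)\<bar>\<close> is a constant times
  \<open>\<bar>exp(\<i> \<langle>w, \<xi>\<rangle>)\<bar> \<bar>T \<psi> (- x)\<bar>\<close>. The function \<open>T \<psi>\<close> decays like \<open>exp(- r \<bar>x\<bar>\<^bsup>1/s\<^esup>)\<close> for every \<open>r\<close>, which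
  beats the exponential factor away from \<open>x = 0\<close> because \<open>t \<le> 1\<close>. Over \<open>x = 0\<close> one follows the curves
  \<open>x = \<lambda>\<^bsup>- s\<^esup> y\<close> with \<open>T \<psi> (- y) \<noteq> 0\<close>; such a \<open>y\<close> exists because \<open>T\<close> is injective, with inverse \<open>exp(- L)\<close>.
\<close>

section \<open>Smooth functions\<close>

text \<open>No analytic continuation is constructed; bounds \<open>C * h ^ n * fact n\<close> on all
  real derivatives of order \<open>n\<close> serve instead. They hold for every \<open>h\<close>,
  because \<open>mi_fact \<beta> powr t \<le> fact (mi_size \<beta>)\<close> for
  \<open>t \<le> 1\<close> and because the Beurling condition allows \<open>h\<close> to be chosen
  after \<open>z\<close>. The same \<open>h\<close> governs the decay of the shifted window, so it
  can also be chosen after the weight \<open>r\<close>, while the neighbourhood \<open>U\<close>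
  stays fixed. Derivatives are indexed by lists of directions: estimates then depend on
  \<open>length\<close> alone, and the Leibniz rule becomes a binomial sum in one index.
  Multi-indices enter only through the definitions of the space and of the series. The delicate
  point is the lower bound over \<open>x = 0\<close>. A nonzero \<open>\<psi>\<close> does not
  directly exhibit a point where its shift is nonzero, and without continuation the inversion of the
  shift has to be carried out on the coefficients of a double series.\<close>

abbreviation pderivs :: "'d::finite list \<Rightarrow> (real ^ 'd \<Rightarrow> complex) \<Rightarrow> real ^ 'd \<Rightarrow> complex" where
  "pderivs is f \<equiv> foldr partial_deriv is f"

lemma partial_derivI: "(f has_derivative f') (at x) \<Longrightarrow> partial_deriv i f x = f' (axis i 1)"
  unfolding partial_deriv_def by (metis frechet_derivative_at)

lemma smooth_has_derivative:
  "smooth f \<Longrightarrow> (f has_derivative frechet_derivative f (at x)) (at x)"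
  unfolding smooth_def differentiable_on_def
  by (metis UNIV_I foldr.simps(1) frechet_derivative_works id_apply)

lemma smooth_partial_deriv: "smooth f \<Longrightarrow> smooth (partial_deriv i f)"
  unfolding smooth_def
proof
  fix "is" :: "'a list"
  assume "\<forall>is. pderivs is f differentiable_on UNIV"
  then have "pderivs (is @ [i]) f differentiable_on UNIV" by blast
  then show "pderivs is (partial_deriv i f) differentiable_on UNIV" by simp
qed

lemma smooth_pderivs: "smooth f \<Longrightarrow> smooth (pderivs is f)"
  by (induction "is") (auto intro: smooth_partial_deriv)

lemma smooth_continuous: "smooth f \<Longrightarrow> continuous_on UNIV f"
  by (meson continuous_at_imp_continuous_on has_derivative_continuous smooth_has_derivative)

text \<open>Smoothness is the largest property that implies differentiability and is preserved by
  \<open>partial_deriv\<close>. Closure properties are therefore proved by naming an invariant class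
  \<open>P\<close>, as in a coinduction.\<close>

lemma smooth_coinduct:
  assumes "P f" and "\<And>g x. P g \<Longrightarrow> g differentiable (at x)"
    and "\<And>g i. P g \<Longrightarrow> P (partial_deriv i g)"
  shows "smooth f"
proof -
  have "P (pderivs is f)" for "is" using assms by (induction "is") auto
  then show ?thesis unfolding smooth_def differentiable_on_def using assms(2) by simp
qed

lemma partial_deriv_linear:
  assumes "smooth f" "smooth g"
  shows "partial_deriv i (\<lambda>x. a * f x + b * g x) =
    (\<lambda>x. a * partial_deriv i f x + b * partial_deriv i g x)"
proof
  fix x
  have "((\<lambda>x. a * f x + b * g x) has_derivative
     (\<lambda>h. a * frechet_derivative f (at x) h + b * frechet_derivative g (at x) h)) (at x)"
    using assms by (auto intro!: derivative_eq_intros smooth_has_derivative)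
  then show "partial_deriv i (\<lambda>x. a * f x + b * g x) x =
      a * partial_deriv i f x + b * partial_deriv i g x"
    by (simp add: partial_derivI) (simp add: partial_deriv_def)
qed

lemma smooth_linear:
  assumes "smooth f" "smooth g"
  shows "smooth (\<lambda>x. a * f x + b * g x)"
proof (rule smooth_coinduct[where P="\<lambda>F. \<exists>f g. smooth f \<and> smooth g \<and> F = (\<lambda>x. a * f x + b * g x)"])
  fix F :: "real ^ 'a \<Rightarrow> complex" and x
  assume "\<exists>f g. smooth f \<and> smooth g \<and> F = (\<lambda>x. a * f x + b * g x)"
  then show "F differentiable (at x)"
    by (auto intro!: differentiable_add differentiable_mult intro: differentiableI smooth_has_derivative)
next
  fix F :: "real ^ 'a \<Rightarrow> complex" and i
  assume "\<exists>f g. smooth f \<and> smooth g \<and> F = (\<lambda>x. a * f x + b * g x)"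
  then show "\<exists>f g. smooth f \<and> smooth g \<and> partial_deriv i F = (\<lambda>x. a * f x + b * g x)"
    using partial_deriv_linear smooth_partial_deriv by metis
qed (use assms in blast)

lemma pderivs_linear:
  assumes "smooth f" "smooth g"
  shows "pderivs is (\<lambda>x. a * f x + b * g x) = (\<lambda>x. a * pderivs is f x + b * pderivs is g x)"
  using assms by (induction "is") (simp_all add: partial_deriv_linear smooth_pderivs)

lemma partial_deriv_zero: "partial_deriv i (\<lambda>_. 0) = (\<lambda>_. 0)"
  unfolding partial_deriv_def by simp

lemma smooth_zero: "smooth (\<lambda>_. 0)"
  by (rule smooth_coinduct[where P="\<lambda>f. f = (\<lambda>_. 0)"]) (auto simp: partial_deriv_zero)

lemma pderivs_zero: "pderivs is (\<lambda>_. 0) = (\<lambda>_. 0)"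
  by (induction "is") (auto simp: partial_deriv_zero)

lemma
  assumes "finite I" "\<And>j. j \<in> I \<Longrightarrow> smooth (f j)"
  shows smooth_sum: "smooth (\<lambda>x. \<Sum>j\<in>I. a j * f j x)"
    and pderivs_sum: "pderivs js (\<lambda>x. \<Sum>j\<in>I. a j * f j x) = (\<lambda>x. \<Sum>j\<in>I. a j * pderivs js (f j) x)"
proof -
  have "smooth (\<lambda>x. \<Sum>j\<in>I. a j * f j x) \<and>
    pderivs js (\<lambda>x. \<Sum>j\<in>I. a j * f j x) = (\<lambda>x. \<Sum>j\<in>I. a j * pderivs js (f j) x)"
    using assms
  proof (induction I)
    case empty
    then show ?case by (simp add: smooth_zero pderivs_zero)
  next
    case (insert j I)
    then have S: "smooth (f j)" "smooth (\<lambda>x. \<Sum>j\<in>I. a j * f j x)" by auto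
    show ?case
      using insert smooth_linear[OF S, of "a j" 1] pderivs_linear[OF S, of js "a j" 1] by simp
  qed
  then show "smooth (\<lambda>x. \<Sum>j\<in>I. a j * f j x)"
    and "pderivs js (\<lambda>x. \<Sum>j\<in>I. a j * f j x) = (\<lambda>x. \<Sum>j\<in>I. a j * pderivs js (f j) x)"
    by auto
qed

lemma partial_deriv_mult:
  assumes "smooth f" "smooth g"
  shows "partial_deriv i (\<lambda>x. f x * g x) =
    (\<lambda>x. 1 * (partial_deriv i f x * g x) + 1 * (f x * partial_deriv i g x))"
proof
  fix x
  have "((\<lambda>x. f x * g x) has_derivative
     (\<lambda>h. f x * frechet_derivative g (at x) h + frechet_derivative f (at x) h * g x)) (at x)"
    using assms by (auto intro!: derivative_eq_intros smooth_has_derivative)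
  then show "partial_deriv i (\<lambda>x. f x * g x) x =
      1 * (partial_deriv i f x * g x) + 1 * (f x * partial_deriv i g x)"
    by (simp add: partial_derivI) (simp add: partial_deriv_def)
qed

text \<open>Products alone are not stable under \<open>partial_deriv\<close>, since the Leibniz rule
  yields two of them. Closing under addition gives an invariant class for
  \<open>smooth_coinduct\<close>.\<close>

inductive sum_of_products :: "(real ^ 'd::finite \<Rightarrow> complex) \<Rightarrow> bool" where
  prod: "smooth f \<Longrightarrow> smooth g \<Longrightarrow> sum_of_products (\<lambda>x. f x * g x)"
| add: "sum_of_products f \<Longrightarrow> sum_of_products g \<Longrightarrow> sum_of_products (\<lambda>x. f x + g x)"

lemma sum_of_products_differentiable: "sum_of_products f \<Longrightarrow> f differentiable (at x)"
proof (induction rule: sum_of_products.induct)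
  case (prod f g)
  then show ?case
    by (intro differentiable_mult) (auto intro: differentiableI smooth_has_derivative)
qed simp

lemma sum_of_products_partial_deriv: "sum_of_products f \<Longrightarrow> sum_of_products (partial_deriv i f)"
proof (induction rule: sum_of_products.induct)
  case (prod f g)
  then show ?case
    by (simp add: partial_deriv_mult sum_of_products.intros smooth_partial_deriv)
next
  case (add f g)
  have "partial_deriv i (\<lambda>x. f x + g x) x = partial_deriv i f x + partial_deriv i g x" for x
  proof -
    have "((\<lambda>x. f x + g x) has_derivative
       (\<lambda>h. frechet_derivative f (at x) h + frechet_derivative g (at x) h)) (at x)"
      using add sum_of_products_differentiable frechet_derivative_works
      by (blast intro: has_derivative_add)
    then show ?thesis by (simp add: partial_derivI) (simp add: partial_deriv_def)
  qed
  then have "partial_deriv i (\<lambda>x. f x + g x) = (\<lambda>x. partial_deriv i f x + partial_deriv i g x)"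
    by blast
  then show ?case using add sum_of_products.add by simp
qed

lemma smooth_mult: "smooth f \<Longrightarrow> smooth g \<Longrightarrow> smooth (\<lambda>x. f x * g x)"
  by (rule smooth_coinduct[where P=sum_of_products])
    (auto intro: sum_of_products.prod sum_of_products_differentiable sum_of_products_partial_deriv)

section \<open>Translations and plane waves\<close>

lemma partial_deriv_translation:
  assumes "smooth f"
  shows "partial_deriv i (translation a f) = translation a (partial_deriv i f)"
proof
  fix x
  have "(translation a f has_derivative frechet_derivative f (at (x - a))) (at x)"
    unfolding translation_def
    by (rule has_derivative_compose[where g=f and f="\<lambda>x. x - a" and f'="\<lambda>h. h"])
      (auto intro!: derivative_eq_intros smooth_has_derivative assms)
  then show "partial_deriv i (translation a f) x = translation a (partial_deriv i f) x"
    by (simp add: partial_derivI) (simp add: partial_deriv_def translation_def)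
qed

lemma smooth_translation: "smooth f \<Longrightarrow> smooth (translation a f)"
proof (rule smooth_coinduct[where P="\<lambda>F. \<exists>f. smooth f \<and> F = translation a f"])
  fix F :: "real ^ 'a \<Rightarrow> complex" and x
  assume "\<exists>f. smooth f \<and> F = translation a f"
  then obtain f where f: "smooth f" "F = translation a f" by blast
  have "(translation a f has_derivative frechet_derivative f (at (x - a))) (at x)"
    unfolding translation_def
    by (rule has_derivative_compose[where g=f and f="\<lambda>x. x - a" and f'="\<lambda>h. h"])
      (auto intro!: derivative_eq_intros smooth_has_derivative f)
  then show "F differentiable (at x)" using f by (auto intro: differentiableI)
next
  fix F :: "real ^ 'a \<Rightarrow> complex" and i
  assume "\<exists>f. smooth f \<and> F = translation a f"
  then show "\<exists>f. smooth f \<and> partial_deriv i F = translation a f"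
    using partial_deriv_translation smooth_partial_deriv by blast
qed auto

lemma pderivs_translation:
  "smooth f \<Longrightarrow> pderivs is (translation a f) = translation a (pderivs is f)"
  by (induction "is") (simp_all add: partial_deriv_translation smooth_pderivs)

abbreviation plane_wave :: "real ^ 'd::finite \<Rightarrow> real ^ 'd \<Rightarrow> complex" where
  "plane_wave \<xi> \<equiv> (\<lambda>y. exp (\<i> * of_real (y \<bullet> \<xi>)))"

lemma plane_wave_derivative:
  "((\<lambda>y. c * plane_wave \<xi> y) has_derivative
     (\<lambda>h. c * (plane_wave \<xi> x * (\<i> * of_real (h \<bullet> \<xi>))))) (at x)"
proof -
  have "((\<lambda>y. \<i> * complex_of_real (y \<bullet> \<xi>)) has_derivative (\<lambda>h. \<i> * of_real (h \<bullet> \<xi>))) (at x)"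
    by (auto intro!: derivative_eq_intros)
  then have "((\<lambda>y. exp (\<i> * complex_of_real (y \<bullet> \<xi>))) has_derivative
     (\<lambda>h. exp (\<i> * of_real (x \<bullet> \<xi>)) * (\<i> * of_real (h \<bullet> \<xi>)))) (at x)"
    by (rule has_derivative_compose[OF _ DERIV_exp[unfolded has_field_derivative_def]])
  then show ?thesis by (intro has_derivative_mult_right)
qed

lemma partial_deriv_plane_wave:
  "partial_deriv i (\<lambda>y. c * plane_wave \<xi> y) = (\<lambda>y. (c * (\<i> * of_real (\<xi> $ i))) * plane_wave \<xi> y)"
proof
  show "partial_deriv i (\<lambda>y. c * plane_wave \<xi> y) x =
      (c * (\<i> * of_real (\<xi> $ i))) * plane_wave \<xi> x" for x
    by (subst partial_derivI[OF plane_wave_derivative]) (simp add: inner_axis')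
qed

lemma smooth_plane_wave: "smooth (plane_wave \<xi>)"
proof (rule smooth_coinduct[where P="\<lambda>F. \<exists>c. F = (\<lambda>y. c * plane_wave \<xi> y)"])
  show "\<exists>c. plane_wave \<xi> = (\<lambda>y. c * plane_wave \<xi> y)" by (rule exI[of _ 1]) simp
next
  fix F :: "real ^ 'a \<Rightarrow> complex" and x
  assume "\<exists>c. F = (\<lambda>y. c * plane_wave \<xi> y)"
  then show "F differentiable (at x)"
    using plane_wave_derivative by (metis differentiableI)
next
  fix F :: "real ^ 'a \<Rightarrow> complex" and i
  assume "\<exists>c. F = (\<lambda>y. c * plane_wave \<xi> y)"
  then show "\<exists>c. partial_deriv i F = (\<lambda>y. c * plane_wave \<xi> y)"
    using partial_deriv_plane_wave by blast
qed

lemma pderivs_plane_wave: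
  "pderivs is (plane_wave \<xi>) = (\<lambda>y. (\<Prod>i\<leftarrow>is. \<i> * of_real (\<xi> $ i)) * plane_wave \<xi> y)"
proof (induction "is")
  case (Cons i "is")
  then show ?case
    using partial_deriv_plane_wave[of i "\<Prod>i\<leftarrow>is. \<i> * of_real (\<xi> $ i)" \<xi>]
    by (simp add: mult_ac)
qed simp

section \<open>Symmetry of mixed partial derivatives\<close>

lemma mixed_differences:
  fixes F :: "real \<Rightarrow> real \<Rightarrow> real"
  assumes "\<And>a b. ((\<lambda>a. F a b) has_real_derivative F1 a b) (at a)"
    and "\<And>a b. ((\<lambda>b. F1 a b) has_real_derivative F12 a b) (at b)"
    and "h > 0"
  shows "\<exists>a b. 0 < a \<and> a < h \<and> 0 < b \<and> b < h \<and>
           F h h - F h 0 - F 0 h + F 0 0 = h * h * F12 a b"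
proof -
  have "\<exists>a>0. a < h \<and> (F h h - F h 0) - (F 0 h - F 0 0) = (h - 0) * (F1 a h - F1 a 0)"
    by (rule MVT2[where f="\<lambda>a. F a h - F a 0"]) (auto intro!: derivative_eq_intros assms)
  then obtain a where a: "0 < a" "a < h"
    "F h h - F h 0 - F 0 h + F 0 0 = h * (F1 a h - F1 a 0)" by auto
  have "\<exists>b>0. b < h \<and> F1 a h - F1 a 0 = (h - 0) * F12 a b"
    by (rule MVT2[where f="\<lambda>b. F1 a b"]) (auto intro!: derivative_eq_intros assms)
  then show ?thesis using a by auto
qed

text \<open>The double difference over a square of side \<open>h\<close> is symmetric in the two
  variables. Divided by \<open>h * h\<close> it is a value of \<open>F12\<close> and also a value of
  \<open>F21\<close> inside the square, and continuity moves both values to the corner.\<close>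

lemma mixed_derivatives_eq:
  fixes F :: "real \<Rightarrow> real \<Rightarrow> real"
  assumes F1: "\<And>a b. ((\<lambda>a. F a b) has_real_derivative F1 a b) (at a)"
    and F12: "\<And>a b. ((\<lambda>b. F1 a b) has_real_derivative F12 a b) (at b)"
    and F2: "\<And>a b. ((\<lambda>b. F a b) has_real_derivative F2 a b) (at b)"
    and F21: "\<And>a b. ((\<lambda>a. F2 a b) has_real_derivative F21 a b) (at a)"
    and c12: "continuous_on UNIV (\<lambda>(a, b). F12 a b)"
    and c21: "continuous_on UNIV (\<lambda>(a, b). F21 a b)"
  shows "F12 0 0 = F21 0 0"
proof (rule ccontr)
  \<comment> \<open>Half of the supposed gap: one number within \<open>e\<close> of both sides is a
    contradiction.\<close>
  define e where "e = \<bar>F12 0 0 - F21 0 0\<bar> / 2"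
  assume "F12 0 0 \<noteq> F21 0 0"
  then have "e > 0" unfolding e_def by simp
  obtain d1 where d1: "d1 > 0" "\<And>p. dist p (0,0) < d1 \<Longrightarrow> dist (F12 (fst p) (snd p)) (F12 0 0) < e"
    using c12 \<open>e > 0\<close> unfolding continuous_on_iff by (force simp: case_prod_beta)
  obtain d2 where d2: "d2 > 0" "\<And>p. dist p (0,0) < d2 \<Longrightarrow> dist (F21 (fst p) (snd p)) (F21 0 0) < e"
    using c21 \<open>e > 0\<close> unfolding continuous_on_iff by (force simp: case_prod_beta)
  \<comment> \<open>The factor 1/2 is needed because the norm of a point of the square is estimated
    by the sum of its two coordinates, which is below \<open>2 * h\<close>.\<close>
  define h where "h = min d1 d2 / 2"
  have h: "h > 0" using d1 d2 unfolding h_def by simp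
  have near: "dist (a, b) (0, 0) < d1" "dist (a, b) (0, 0) < d2"
    if "0 < a" "a < h" "0 < b" "b < h" for a b :: real
  proof -
    have "norm (a, b) \<le> \<bar>a\<bar> + \<bar>b\<bar>"
      using norm_Pair_le[of a b] by simp
    then show "dist (a, b) (0, 0) < d1" "dist (a, b) (0, 0) < d2"
      using that unfolding h_def by (auto simp: dist_norm zero_prod_def[symmetric])
  qed
  obtain a b where ab: "0 < a" "a < h" "0 < b" "b < h"
    "F h h - F h 0 - F 0 h + F 0 0 = h * h * F12 a b"
    using mixed_differences[OF F1 F12 h] by blast
  \<comment> \<open>The same double difference, with the variables exchanged.\<close>
  obtain a' b' where ab': "0 < a'" "a' < h" "0 < b'" "b' < h"
    "F h h - F 0 h - F h 0 + F 0 0 = h * h * F21 b' a'"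
    using mixed_differences[of "\<lambda>b a. F a b", OF F2 F21 h] by blast
  have "h * h * F12 a b = h * h * F21 b' a'" using ab(5) ab'(5) by linarith
  then have "F12 a b = F21 b' a'" using h by simp
  moreover have "\<bar>F12 a b - F12 0 0\<bar> < e" using d1(2)[of "(a,b)"] near ab by (simp add: dist_real_def)
  moreover have "\<bar>F21 b' a' - F21 0 0\<bar> < e" using d2(2)[of "(b',a')"] near ab' by (simp add: dist_real_def)
  ultimately show False unfolding e_def by argo
qed

lemma partial_deriv_line:
  assumes "smooth f"
  shows "((\<lambda>t. f (x + t *\<^sub>R axis i 1)) has_vector_derivative
    partial_deriv i f (x + t *\<^sub>R axis i 1)) (at t)"
proof -
  have D: "(f has_derivative frechet_derivative f (at (x + t *\<^sub>R axis i 1))) (at (x + t *\<^sub>R axis i 1))"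
    by (rule smooth_has_derivative[OF assms])
  have "((\<lambda>t. f (x + t *\<^sub>R axis i 1)) has_derivative
    (\<lambda>h. frechet_derivative f (at (x + t *\<^sub>R axis i 1)) (h *\<^sub>R axis i 1))) (at t)"
    by (rule has_derivative_compose[where g=f and f="\<lambda>t. x + t *\<^sub>R axis i 1", OF _ D]) (auto intro!: derivative_eq_intros)
  then show ?thesis
    unfolding has_vector_derivative_def partial_deriv_def
    using linear_scale[OF has_derivative_linear[OF D]] by simp
qed

lemma partial_deriv_commute:
  assumes f: "smooth f"
  shows "partial_deriv i (partial_deriv j f) = partial_deriv j (partial_deriv i f)"
proof
  fix x :: "real ^ 'a"
  define p where "p a b = x + a *\<^sub>R axis j 1 + b *\<^sub>R axis i 1" for a b :: real
  have p': "p a b = x + b *\<^sub>R axis i 1 + a *\<^sub>R axis j 1" for a b by (simp add: p_def)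
  have D: "((\<lambda>b. g (p a b)) has_vector_derivative partial_deriv i g (p a b)) (at b)"
    "((\<lambda>a. g (p a b)) has_vector_derivative partial_deriv j g (p a b)) (at a)"
    if "smooth g" for g a b
    using partial_deriv_line[OF that] unfolding p_def
    by (simp, subst (1 2) p'[unfolded p_def]) (simp add: partial_deriv_line[OF that])
  have cont: "continuous_on UNIV (\<lambda>(a, b). g (p a b))" if "smooth g" for g
    unfolding case_prod_beta p_def
    by (rule continuous_on_compose2[OF smooth_continuous[OF that]]) (auto intro!: continuous_intros)
  \<comment> \<open>The mean value theorem fails for complex values, so the claim is tested by
    real-linear functionals; \<open>Re\<close> and \<open>Im\<close> suffice.\<close>
  have eq: "L (partial_deriv i (partial_deriv j f) (p 0 0)) = L (partial_deriv j (partial_deriv i f) (p 0 0))"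
    if L: "bounded_linear L" for L :: "complex \<Rightarrow> real"
  proof (rule mixed_derivatives_eq[where F="\<lambda>a b. L (f (p a b))" and ?F1.0="\<lambda>a b. L (partial_deriv j f (p a b))"
        and ?F2.0="\<lambda>a b. L (partial_deriv i f (p a b))"
        and ?F12.0="\<lambda>a b. L (partial_deriv i (partial_deriv j f) (p a b))"
        and ?F21.0="\<lambda>a b. L (partial_deriv j (partial_deriv i f) (p a b))"])
    show "continuous_on UNIV (\<lambda>(a, b). L (partial_deriv i (partial_deriv j f) (p a b)))"
      "continuous_on UNIV (\<lambda>(a, b). L (partial_deriv j (partial_deriv i f) (p a b)))"
      using cont[of "partial_deriv i (partial_deriv j f)"] cont[of "partial_deriv j (partial_deriv i f)"] f
      by (auto simp: case_prod_beta smooth_partial_deriv intro!: bounded_linear.continuous_on[OF L])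
  qed (unfold has_real_derivative_iff_has_vector_derivative,
      auto intro!: bounded_linear.has_vector_derivative[OF L] D smooth_partial_deriv f)
  have "p 0 0 = x" by (simp add: p_def)
  then show "partial_deriv i (partial_deriv j f) x = partial_deriv j (partial_deriv i f) x"
    using eq[OF bounded_linear_Re] eq[OF bounded_linear_Im] by (simp add: complex_eq_iff)
qed

section \<open>Complex shifts\<close>

definition dir_deriv :: "complex ^ 'd::finite \<Rightarrow> (real ^ 'd \<Rightarrow> complex) \<Rightarrow> real ^ 'd \<Rightarrow> complex" where
  "dir_deriv w f = (\<lambda>x. \<Sum>i\<in>UNIV. w $ i * partial_deriv i f x)"

text \<open>The Taylor series is grouped by total order, which makes it a series in one index.
  Convergence is guaranteed for smooth \<open>f\<close> with \<open>entire_at f x\<close>.\<close>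

definition cshift :: "complex ^ 'd::finite \<Rightarrow> (real ^ 'd \<Rightarrow> complex) \<Rightarrow> real ^ 'd \<Rightarrow> complex" where
  "cshift w f = (\<lambda>x. \<Sum>n. (dir_deriv w ^^ n) f x / fact n)"

text \<open>At \<open>x\<close> the Taylor series of such a smooth \<open>f\<close> has infinite
  radius of convergence. Quantifying over lists bounds derivatives in any order at once.\<close>

definition entire_at :: "(real ^ 'd::finite \<Rightarrow> complex) \<Rightarrow> real ^ 'd \<Rightarrow> bool" where
  "entire_at f x \<longleftrightarrow> (\<forall>h>0. \<exists>C. \<forall>is. cmod (pderivs is f x) \<le> C * h ^ length is * fact (length is))"

abbreviation wsum :: "complex ^ 'd::finite \<Rightarrow> real" where
  "wsum w \<equiv> \<Sum>i\<in>UNIV. cmod (w $ i)"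

lemma smooth_dir_deriv: "smooth f \<Longrightarrow> smooth (dir_deriv w f)"
  unfolding dir_deriv_def by (intro smooth_sum smooth_partial_deriv) auto

lemma smooth_dir_deriv_pow: "smooth f \<Longrightarrow> smooth ((dir_deriv w ^^ n) f)"
  by (induction n) (auto intro: smooth_dir_deriv)

lemma pderivs_dir_deriv:
  "smooth f \<Longrightarrow> pderivs is (dir_deriv w f) x = (\<Sum>i\<in>UNIV. w $ i * pderivs (is @ [i]) f x)"
  unfolding dir_deriv_def by (simp add: pderivs_sum smooth_partial_deriv)

lemma dir_deriv_linear:
  assumes "smooth f" "smooth g"
  shows "dir_deriv w (\<lambda>x. a * f x + b * g x) = (\<lambda>x. a * dir_deriv w f x + b * dir_deriv w g x)"
  unfolding dir_deriv_def partial_deriv_linear[OF assms]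
  by (simp add: sum.distrib sum_distrib_left algebra_simps)

lemma dir_deriv_pow_add:
  assumes "smooth f" "smooth g"
  shows "(dir_deriv w ^^ n) (\<lambda>x. f x + g x) = (\<lambda>x. (dir_deriv w ^^ n) f x + (dir_deriv w ^^ n) g x)"
proof (induction n)
  case (Suc n)
  then show ?case
    using dir_deriv_linear[OF smooth_dir_deriv_pow[OF assms(1)] smooth_dir_deriv_pow[OF assms(2)],
        where a=1 and b=1] by simp
qed simp

lemma dir_deriv_mult:
  assumes "smooth f" "smooth g"
  shows "dir_deriv w (\<lambda>x. f x * g x) = (\<lambda>x. dir_deriv w f x * g x + f x * dir_deriv w g x)"
  unfolding dir_deriv_def partial_deriv_mult[OF assms]
  by (simp add: sum.distrib sum_distrib_left sum_distrib_right algebra_simps)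

text \<open>One application of \<open>dir_deriv w\<close> costs a factor \<open>wsum w\<close> and
  one order: \<open>dir_deriv w f\<close> satisfies the hypothesis with majorant
  \<open>wsum w * a (Suc k)\<close>. Hence the induction leaves both \<open>f\<close> and
  \<open>a\<close> arbitrary.\<close>

lemma pderivs_dir_deriv_pow_bound:
  assumes "smooth f" "\<And>is. cmod (pderivs is f x) \<le> a (length is)"
  shows "cmod (pderivs js ((dir_deriv w ^^ n) f) x) \<le> wsum w ^ n * a (length js + n)"
  using assms
proof (induction n arbitrary: f a)
  case 0
  then show ?case by simp
next
  case (Suc n)
  have "cmod (pderivs is (dir_deriv w f) x) \<le> wsum w * a (Suc (length is))" for "is"
  proof -
    have "cmod (pderivs is (dir_deriv w f) x) \<le> (\<Sum>i\<in>UNIV. cmod (w $ i) * cmod (pderivs (is @ [i]) f x))"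
      unfolding pderivs_dir_deriv[OF Suc.prems(1)] by (rule sum_norm_le) (simp add: norm_mult)
    also have "\<dots> \<le> (\<Sum>i\<in>UNIV. cmod (w $ i) * a (Suc (length is)))"
      using Suc.prems(2)[of "is @ [_]"] by (intro sum_mono mult_left_mono) auto
    finally show ?thesis by (simp add: sum_distrib_right)
  qed
  then have "cmod (pderivs js ((dir_deriv w ^^ n) (dir_deriv w f)) x)
      \<le> wsum w ^ n * (wsum w * a (Suc (length js + n)))"
    using Suc.IH[OF smooth_dir_deriv[OF Suc.prems(1)], where a="\<lambda>k. wsum w * a (Suc k)"] by simp
  then show ?case by (simp add: funpow_swap1 mult_ac)
qed

lemma dir_deriv_pow_bound:
  assumes "smooth f" "\<And>is. cmod (pderivs is f x) \<le> a (length is)"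
  shows "cmod ((dir_deriv w ^^ n) f x) \<le> wsum w ^ n * a n"
  using pderivs_dir_deriv_pow_bound[OF assms, of "[]"] by simp

text \<open>Pascal's rule, in the form of the induction step of a Leibniz formula:
  \<open>F k l\<close> stands for the term with \<open>k\<close> derivatives on the first factor and
  \<open>l\<close> on the second. It serves both the estimate for lists and the exact formula for
  powers of \<open>dir_deriv w\<close>.\<close>

lemma binomial_sum_Suc:
  fixes F :: "nat \<Rightarrow> nat \<Rightarrow> 'a::comm_semiring_1"
  shows "(\<Sum>k\<le>Suc n. of_nat (Suc n choose k) * F k (Suc n - k)) =
    (\<Sum>k\<le>n. of_nat (n choose k) * F (Suc k) (n - k)) + (\<Sum>k\<le>n. of_nat (n choose k) * F k (Suc (n - k)))"
proof -
  have "(\<Sum>k\<le>Suc n. of_nat (Suc n choose k) * F k (Suc n - k)) =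
    F 0 (Suc n) + (\<Sum>k\<le>n. of_nat (Suc n choose Suc k) * F (Suc k) (n - k))"
    by (subst sum.atMost_Suc_shift) simp
  also have "(\<Sum>k\<le>n. of_nat (Suc n choose Suc k) * F (Suc k) (n - k)) =
    (\<Sum>k\<le>n. of_nat (n choose k) * F (Suc k) (n - k)) +
    (\<Sum>k\<le>n. of_nat (n choose Suc k) * F (Suc k) (n - k))"
    by (simp add: sum.distrib algebra_simps)
  also have "F 0 (Suc n) + \<dots> = (\<Sum>k\<le>n. of_nat (n choose k) * F (Suc k) (n - k)) +
    (F 0 (Suc n) + (\<Sum>k\<le>n. of_nat (n choose Suc k) * F (Suc k) (n - k)))"
    by (simp add: algebra_simps)
  also have "F 0 (Suc n) + (\<Sum>k\<le>n. of_nat (n choose Suc k) * F (Suc k) (n - k)) =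
     (\<Sum>k\<le>Suc n. of_nat (n choose k) * F k (Suc n - k))"
    by (subst sum.atMost_Suc_shift) simp
  also have "\<dots> = (\<Sum>k\<le>n. of_nat (n choose k) * F k (Suc (n - k)))"
    by (simp add: Suc_diff_le binomial_eq_0)
  finally show ?thesis .
qed

text \<open>An exact Leibniz formula would run over all splittings of the list, but the majorants
  see only lengths, so the splittings with equal lengths are collected by a binomial coefficient.
  The induction is from the right because the last entry of the list is the derivative taken
  first.\<close>

lemma pderivs_mult_bound:
  fixes a b :: "nat \<Rightarrow> real"
  assumes "smooth f" "smooth g" "\<And>is. cmod (pderivs is f x) \<le> a (length is)"
    "\<And>is. cmod (pderivs is g x) \<le> b (length is)"
  shows "cmod (pderivs is (\<lambda>x. f x * g x) x) \<le>
    (\<Sum>k\<le>length is. of_nat (length is choose k) * (a k * b (length is - k)))"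
  using assms
proof (induction "is" arbitrary: f g a b rule: rev_induct)
  case Nil
  have "cmod (f x * g x) \<le> a 0 * b 0"
    unfolding norm_mult using Nil(3)[of "[]"] Nil(4)[of "[]"]
    by (intro mult_mono) (auto intro: order_trans[OF norm_ge_zero])
  then show ?case by simp
next
  case (snoc i "is")
  let ?n = "length is"
  have S: "smooth (partial_deriv i f)" "smooth (partial_deriv i g)"
    using snoc.prems smooth_partial_deriv by auto
  have bf: "cmod (pderivs is (partial_deriv i f) x) \<le> a (Suc (length is))"
    and bg: "cmod (pderivs is (partial_deriv i g) x) \<le> b (Suc (length is))" for "is"
    using snoc.prems(3)[of "is @ [i]"] snoc.prems(4)[of "is @ [i]"] by auto
  have "pderivs (is @ [i]) (\<lambda>x. f x * g x) x =
     pderivs is (\<lambda>x. partial_deriv i f x * g x) x + pderivs is (\<lambda>x. f x * partial_deriv i g x) x"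
    using pderivs_linear[OF smooth_mult smooth_mult, OF S(1) snoc.prems(2,1) S(2), of "is" 1 1]
    by (simp add: partial_deriv_mult[OF snoc.prems(1,2)])
  also have "cmod \<dots> \<le> (\<Sum>k\<le>?n. of_nat (?n choose k) * (a (Suc k) * b (?n - k))) +
      (\<Sum>k\<le>?n. of_nat (?n choose k) * (a k * b (Suc (?n - k))))"
    using snoc.IH[of "partial_deriv i f" g "\<lambda>k. a (Suc k)" b]
      snoc.IH[of f "partial_deriv i g" a "\<lambda>k. b (Suc k)"] snoc.prems S bf bg
    by (intro norm_triangle_mono) auto
  also have "\<dots> = (\<Sum>k\<le>Suc ?n. of_nat (Suc ?n choose k) * (a k * b (Suc ?n - k)))"
    by (rule binomial_sum_Suc[symmetric])
  finally show ?case by simp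
qed

lemma entire_atD:
  assumes "entire_at f x" "h > 0"
  obtains C where "C \<ge> 0" "\<And>is. cmod (pderivs is f x) \<le> C * h ^ length is * fact (length is)"
proof -
  obtain C where C: "\<And>is. cmod (pderivs is f x) \<le> C * h ^ length is * fact (length is)"
    using assms unfolding entire_at_def by blast
  moreover have "C \<ge> 0" using C[of "[]"] by (simp add: order_trans[OF norm_ge_zero])
  ultimately show ?thesis using that by blast
qed

lemma Suc_le_two_power: "real (Suc n) \<le> 2 ^ n"
  using less_exp[of n] by (metis Suc_leI of_nat_le_iff of_nat_numeral of_nat_power)

text \<open>With \<open>h / 2\<close> for each factor, every term of the Leibniz sum becomes the
  same: the binomial coefficient turns \<open>fact k * fact (n - k)\<close> into
  \<open>fact n\<close>. The number \<open>n + 1\<close> of terms is absorbed by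
  \<open>2 ^ n\<close>, which restores \<open>h\<close>.\<close>

lemma entire_at_mult:
  assumes f: "smooth f" "entire_at f x" and g: "smooth g" "entire_at g x"
  shows "entire_at (\<lambda>x. f x * g x) x"
  unfolding entire_at_def
proof (intro allI impI)
  fix h :: real assume "h > 0"
  then have "h / 2 > 0" by simp
  obtain A where A: "A \<ge> 0" "\<And>is. cmod (pderivs is f x) \<le> A * (h/2) ^ length is * fact (length is)"
    using entire_atD[OF f(2) \<open>h / 2 > 0\<close>] by metis
  obtain B where B: "B \<ge> 0" "\<And>is. cmod (pderivs is g x) \<le> B * (h/2) ^ length is * fact (length is)"
    using entire_atD[OF g(2) \<open>h / 2 > 0\<close>] by metis
  have "cmod (pderivs is (\<lambda>x. f x * g x) x) \<le> A * B * h ^ length is * fact (length is)" for "is"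
  proof -
    let ?n = "length is"
    have "cmod (pderivs is (\<lambda>x. f x * g x) x) \<le> (\<Sum>k\<le>?n. of_nat (?n choose k) *
        ((A * (h/2) ^ k * fact k) * (B * (h/2) ^ (?n - k) * fact (?n - k))))"
      by (rule pderivs_mult_bound[OF f(1) g(1) A(2) B(2)])
    also have "\<dots> = (\<Sum>k\<le>?n. A * B * (h/2) ^ ?n * fact ?n)"
    proof (rule sum.cong)
      fix k assume "k \<in> {..?n}"
      then have k: "k \<le> ?n" by simp
      have "of_nat (?n choose k) * ((A * (h/2) ^ k * fact k) * (B * (h/2) ^ (?n - k) * fact (?n - k))) =
        A * B * ((h/2) ^ k * (h/2) ^ (?n - k)) * (fact k * fact (?n - k) * of_nat (?n choose k))"
        by (simp add: mult_ac)
      also have "fact k * fact (?n - k) * real (?n choose k) = fact ?n"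
        using binomial_fact_lemma[OF k] by (metis of_nat_fact of_nat_mult)
      also have "(h/2) ^ k * (h/2) ^ (?n - k) = (h/2) ^ ?n"
        using k by (simp flip: power_add)
      finally show "of_nat (?n choose k) * ((A * (h/2) ^ k * fact k) * (B * (h/2) ^ (?n - k) * fact (?n - k)))
        = A * B * (h/2) ^ ?n * fact ?n" .
    qed simp
    also have "\<dots> = A * B * fact ?n * (h/2) ^ ?n * real (Suc ?n)" by (simp add: algebra_simps)
    also have "\<dots> \<le> A * B * fact ?n * (h/2) ^ ?n * 2 ^ ?n"
      using A(1) B(1) \<open>h > 0\<close> by (intro mult_left_mono Suc_le_two_power) auto
    also have "\<dots> = A * B * h ^ ?n * fact ?n" by (simp add: power_divide)
    finally show ?thesis .
  qed
  then show "\<exists>C. \<forall>is. cmod (pderivs is (\<lambda>x. f x * g x) x) \<le> C * h ^ length is * fact (length is)"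
    by blast
qed

lemma entire_at_translation:
  "smooth f \<Longrightarrow> entire_at f (x - a) \<Longrightarrow> entire_at (translation a f) x"
  unfolding entire_at_def by (simp add: pderivs_translation) (simp add: translation_def)

lemma power_le_exp_fact: "(y::real) \<ge> 0 \<Longrightarrow> y ^ n \<le> exp y * fact n"
proof -
  assume y: "y \<ge> 0"
  have "y ^ n / fact n = (\<Sum>k\<in>{n}. y ^ k /\<^sub>R fact k)" by (simp add: divide_inverse mult.commute)
  also have "\<dots> \<le> (\<Sum>k. y ^ k /\<^sub>R fact k)"
    using y by (intro sum_le_suminf summable_exp_generic) auto
  finally show ?thesis by (simp add: exp_def field_simps)
qed

lemma entire_at_plane_wave: "entire_at (plane_wave \<xi>) x"
  unfolding entire_at_def
proof (intro allI impI)
  fix h :: real assume h: "h > 0"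
  define K where "K = norm \<xi>"
  have "cmod (pderivs is (plane_wave \<xi>) x) \<le> K ^ length is" for "is"
  proof -
    have "cmod (\<Prod>i\<leftarrow>is. \<i> * of_real (\<xi> $ i)) \<le> K ^ length is"
    proof (induction "is")
      case (Cons i "is")
      have "\<bar>\<xi> $ i\<bar> \<le> K" unfolding K_def by (rule component_le_norm_cart)
      then show ?case using Cons by (auto simp: norm_mult intro!: mult_mono)
    qed simp
    then show ?thesis by (simp add: pderivs_plane_wave norm_mult)
  qed
  \<comment> \<open>A single term of the exponential series of \<open>K / h\<close> is at most its
    sum.\<close>
  moreover have "K ^ n \<le> exp (K / h) * h ^ n * fact n" for n
    using power_le_exp_fact[of "K / h" n] h unfolding K_def by (simp add: power_divide field_simps)
  ultimately show "\<exists>C. \<forall>is. cmod (pderivs is (plane_wave \<xi>) x) \<le> C * h ^ length is * fact (length is)"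
    using order_trans by blast
qed

lemma cshift_term_bound:
  assumes "smooth f" "\<And>is. cmod (pderivs is f x) \<le> C * h ^ length is * fact (length is)"
  shows "cmod ((dir_deriv w ^^ n) f x / fact n) \<le> C * (wsum w * h) ^ n"
  using dir_deriv_pow_bound[where a="\<lambda>n. C * h ^ n * fact n" and w=w and n=n, OF assms]
  by (simp add: norm_divide divide_le_eq power_mult_distrib mult_ac)

text \<open>The series for \<open>cshift w\<close> is majorised by a geometric series with ratio
  \<open>wsum w * h\<close>. Making this small for arbitrary \<open>w\<close> is what requires
  bounds for every \<open>h\<close>; a single \<open>h\<close> would restrict \<open>w\<close>. The
  \<open>1 +\<close> in the witness covers \<open>w = 0\<close>.\<close>

lemma small_step: "\<exists>h>0. h \<le> H \<and> wsum w * h \<le> q" if "H > 0" "q > 0"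
proof -
  have W: "wsum w \<ge> 0" by (simp add: sum_nonneg)
  let ?h = "min H (q / (1 + wsum w))"
  have "wsum w * ?h \<le> (1 + wsum w) * (q / (1 + wsum w))" using W that by (intro mult_mono) auto
  also have "\<dots> = q" using W by simp
  finally show ?thesis using that W by (intro exI[of _ ?h]) auto
qed

lemma cshift_summable:
  assumes "smooth f" "entire_at f x"
  shows "summable (\<lambda>n. norm ((dir_deriv w ^^ n) f x / fact n))"
proof -
  obtain h where h: "h > 0" "wsum w * h \<le> 1/2" using small_step[of 1 "1/2" w] by auto
  obtain C where C: "C \<ge> 0" "\<And>is. cmod (pderivs is f x) \<le> C * h ^ length is * fact (length is)"
    using entire_atD[OF assms(2) h(1)] by metis
  have "norm ((dir_deriv w ^^ n) f x / fact n) \<le> C * (1/2) ^ n" for n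
  proof -
    have "norm ((dir_deriv w ^^ n) f x / fact n) \<le> C * (wsum w * h) ^ n"
      by (rule cshift_term_bound[OF assms(1) C(2)])
    also have "\<dots> \<le> C * (1/2) ^ n"
      using h C(1) by (intro mult_left_mono power_mono) (auto intro!: mult_nonneg_nonneg sum_nonneg)
    finally show ?thesis .
  qed
  then have "norm (norm ((dir_deriv w ^^ n) f x / fact n)) \<le> C * (1/2) ^ n" for n
    by simp
  moreover have "summable (\<lambda>n. C * (1/2::real) ^ n)"
    by (intro summable_mult summable_geometric) simp
  ultimately show ?thesis
    by (blast intro: summable_comparison_test')
qed

lemma dir_deriv_pow_mult:
  assumes "smooth f" "smooth g"
  shows "(dir_deriv w ^^ n) (\<lambda>x. f x * g x) x =
    (\<Sum>k\<le>n. of_nat (n choose k) * ((dir_deriv w ^^ k) f x * (dir_deriv w ^^ (n - k)) g x))"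
  using assms
proof (induction n arbitrary: f g)
  case (Suc n)
  note S = Suc.prems smooth_dir_deriv[OF Suc.prems(1), of w] smooth_dir_deriv[OF Suc.prems(2), of w]
  have "(dir_deriv w ^^ Suc n) (\<lambda>x. f x * g x) x =
     (dir_deriv w ^^ n) (\<lambda>x. dir_deriv w f x * g x + f x * dir_deriv w g x) x"
    using S by (simp add: funpow_swap1 dir_deriv_mult)
  also have "\<dots> = (dir_deriv w ^^ n) (\<lambda>x. dir_deriv w f x * g x) x +
      (dir_deriv w ^^ n) (\<lambda>x. f x * dir_deriv w g x) x"
    using S by (simp add: dir_deriv_pow_add smooth_mult)
  also have "\<dots> = (\<Sum>k\<le>Suc n. of_nat (Suc n choose k) *
      ((dir_deriv w ^^ k) f x * (dir_deriv w ^^ (Suc n - k)) g x))"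
    unfolding binomial_sum_Suc[where F="\<lambda>k l. (dir_deriv w ^^ k) f x * (dir_deriv w ^^ l) g x"]
    using S by (simp add: Suc.IH funpow_swap1)
  finally show ?case .
qed simp

text \<open>Divided by \<open>fact n\<close>, the Leibniz formula for
  \<open>dir_deriv w ^^ n\<close> is the \<open>n\<close>-th term of the Cauchy product of two
  absolutely convergent series.\<close>

lemma cshift_mult:
  assumes f: "smooth f" "entire_at f x" and g: "smooth g" "entire_at g x"
  shows "cshift w (\<lambda>x. f x * g x) x = cshift w f x * cshift w g x"
proof -
  have "(dir_deriv w ^^ n) (\<lambda>x. f x * g x) x / fact n =
    (\<Sum>k\<le>n. ((dir_deriv w ^^ k) f x / fact k) * ((dir_deriv w ^^ (n - k)) g x / fact (n - k)))" for n
    unfolding dir_deriv_pow_mult[OF f(1) g(1)] sum_divide_distrib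
    by (rule sum.cong) (auto simp: binomial_fact field_simps)
  then show ?thesis
    unfolding cshift_def
    using Cauchy_product[OF cshift_summable[OF f] cshift_summable[OF g]] by simp
qed

lemma dir_deriv_pow_plane_wave:
  "(dir_deriv w ^^ n) (plane_wave \<xi>) = (\<lambda>y. (\<i> * (\<Sum>i\<in>UNIV. w $ i * of_real (\<xi> $ i))) ^ n * plane_wave \<xi> y)"
proof (induction n)
  case (Suc n)
  show ?case
    unfolding funpow.simps comp_def Suc
    unfolding dir_deriv_def partial_deriv_plane_wave
    by (simp add: sum_distrib_left sum_distrib_right mult_ac)
qed simp

lemma cshift_plane_wave:
  "cshift w (plane_wave \<xi>) x = exp (\<i> * (\<Sum>i\<in>UNIV. w $ i * of_real (\<xi> $ i))) * plane_wave \<xi> x"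
proof -
  let ?c = "\<i> * (\<Sum>i\<in>UNIV. w $ i * of_real (\<xi> $ i))"
  have "(\<lambda>n. (?c ^ n /\<^sub>R fact n) * plane_wave \<xi> x) sums (exp ?c * plane_wave \<xi> x)"
    by (intro sums_mult2 exp_converges)
  moreover have "(?c ^ n /\<^sub>R fact n) * plane_wave \<xi> x = (dir_deriv w ^^ n) (plane_wave \<xi>) x / fact n" for n
    unfolding dir_deriv_pow_plane_wave by (simp add: scaleR_conv_of_real field_simps)
  ultimately have "(\<lambda>n. (dir_deriv w ^^ n) (plane_wave \<xi>) x / fact n) sums (exp ?c * plane_wave \<xi> x)"
    by simp
  then show ?thesis unfolding cshift_def by (rule sums_unique[symmetric])
qed

lemma dir_deriv_translation:
  "smooth f \<Longrightarrow> dir_deriv w (translation a f) = translation a (dir_deriv w f)"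
  unfolding dir_deriv_def by (simp add: partial_deriv_translation) (simp add: translation_def)

lemma cshift_translation:
  assumes "smooth f"
  shows "cshift w (translation a f) x = cshift w f (x - a)"
proof -
  have "(dir_deriv w ^^ n) (translation a f) = translation a ((dir_deriv w ^^ n) f)" for n
    by (induction n) (simp_all add: dir_deriv_translation smooth_dir_deriv_pow assms)
  then show ?thesis unfolding cshift_def by (simp add: translation_def)
qed

section \<open>Uniform bounds and injectivity of the complex shift\<close>

definition entire_type :: "(real ^ 'd::finite \<Rightarrow> complex) \<Rightarrow> bool" where
  "entire_type f \<longleftrightarrow>
    (\<forall>h>0. \<exists>C. \<forall>is x. cmod (pderivs is f x) \<le> C * h ^ length is * fact (length is))"

lemma entire_type_imp_entire_at: "entire_type f \<Longrightarrow> entire_at f x"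
  unfolding entire_type_def entire_at_def by blast

lemma entire_typeD:
  assumes "entire_type f" "h > 0"
  obtains C where "C \<ge> 0" "\<And>is x. cmod (pderivs is f x) \<le> C * h ^ length is * fact (length is)"
proof -
  obtain C where C: "\<And>is x. cmod (pderivs is f x) \<le> C * h ^ length is * fact (length is)"
    using assms unfolding entire_type_def by blast
  moreover have "C \<ge> 0" using C[of "[]" undefined] by (simp add: order_trans[OF norm_ge_zero])
  ultimately show ?thesis using that by blast
qed

lemma entire_type_dir_deriv:
  assumes "smooth f" "entire_type f"
  shows "entire_type (dir_deriv w f)"
  unfolding entire_type_def
proof (intro allI impI)
  fix h :: real assume h: "h > 0"
  then have "h / 2 > 0" by simp
  then obtain C where C: "C \<ge> 0"
    "\<And>is x. cmod (pderivs is f x) \<le> C * (h/2) ^ length is * fact (length is)"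
    using entire_typeD[OF assms(2)] by metis
  let ?C = "wsum w * (C * (h/2))"
  have C0: "?C \<ge> 0" using C(1) h by (intro mult_nonneg_nonneg sum_nonneg) auto
  have "cmod (pderivs is (dir_deriv w f) x) \<le> ?C * h ^ length is * fact (length is)" for "is" x
  proof -
    let ?n = "length is"
    have "cmod (pderivs is (dir_deriv w f) x) \<le> wsum w * (C * (h/2) ^ Suc ?n * fact (Suc ?n))"
      using pderivs_dir_deriv_pow_bound[where n=1 and w=w and a="\<lambda>n. C * (h/2) ^ n * fact n",
          OF assms(1) C(2)] by simp
    also have "\<dots> = ?C * (h/2) ^ ?n * fact ?n * real (Suc ?n)" by (simp add: algebra_simps)
    also have "\<dots> \<le> ?C * (h/2) ^ ?n * fact ?n * 2 ^ ?n"
      using C0 h by (intro mult_left_mono Suc_le_two_power mult_nonneg_nonneg[OF mult_nonneg_nonneg]) auto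
    also have "\<dots> = ?C * h ^ ?n * fact ?n" by (simp add: power_divide)
    finally show ?thesis .
  qed
  then show "\<exists>C. \<forall>is x. cmod (pderivs is (dir_deriv w f) x) \<le> C * h ^ length is * fact (length is)"
    by blast
qed

text \<open>Formally the shift commutes with \<open>dir_deriv w\<close>, so the claim is the
  derivative of the hypothesis. The series is differentiated term by term along each axis, which is
  justified by the uniformity in \<open>x\<close> of the bounds in
  \<open>entire_type\<close>.\<close>

lemma cshift_dir_deriv_eq_0:
  assumes g: "smooth g" "entire_type g" and zero: "\<And>x. cshift w g x = 0"
  shows "cshift w (dir_deriv w g) x = 0"
proof -
  \<comment> \<open>The differentiated terms carry an extra factor \<open>n + 1\<close>, at most
    \<open>2 ^ n\<close>; ratio 1/4 leaves a geometric series with ratio 1/2.\<close>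
  obtain h where h: "h > 0" "wsum w * h \<le> 1/4" using small_step[of 1 "1/4" w] by auto
  obtain C where C: "C \<ge> 0" "\<And>is x. cmod (pderivs is g x) \<le> C * h ^ length is * fact (length is)"
    using entire_typeD[OF g(2) h(1)] by metis
  have W: "wsum w \<ge> 0" by (simp add: sum_nonneg)
  have part: "(\<lambda>n. partial_deriv i ((dir_deriv w ^^ n) g) x / fact n) sums 0" for i
  proof -
    define D where "D n t = partial_deriv i ((dir_deriv w ^^ n) g) (x + t *\<^sub>R axis i 1) / fact n" for n t
    define F where "F n t = (dir_deriv w ^^ n) g (x + t *\<^sub>R axis i 1) / fact n" for n t
    have D_bound: "cmod (D n t) \<le> C * h * (1/2) ^ n" for n t
    proof -
      have "cmod (partial_deriv i ((dir_deriv w ^^ n) g) (x + t *\<^sub>R axis i 1))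
          \<le> wsum w ^ n * (C * h ^ Suc n * fact (Suc n))"
        using pderivs_dir_deriv_pow_bound[where n=n and w=w and a="\<lambda>n. C * h ^ n * fact n" and js="[i]",
            OF g(1) C(2)] by simp
      then have "cmod (D n t) \<le> wsum w ^ n * (C * h ^ Suc n * fact (Suc n)) / fact n"
        unfolding D_def norm_divide norm_fact by (rule divide_right_mono) simp
      also have "\<dots> = C * h * ((wsum w * h) ^ n * real (Suc n))"
        by (simp add: power_mult_distrib field_simps)
      also have "\<dots> \<le> C * h * ((1/4) ^ n * 2 ^ n)"
        using C(1) h W Suc_le_two_power[of n] by (intro mult_left_mono mult_mono power_mono) auto
      also have "\<dots> = C * h * (1/2) ^ n"
        by (simp flip: power_mult_distrib)
      finally show ?thesis .
    qed
    have sumD: "summable (\<lambda>n. C * h * (1/2::real) ^ n)"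
      by (intro summable_mult summable_geometric) simp
    have unif: "uniform_limit UNIV (\<lambda>n t. \<Sum>i<n. D i t) (\<lambda>t. \<Sum>i. D i t) sequentially"
      by (rule Weierstrass_m_test[OF _ sumD]) (use D_bound in auto)
    have Fsums: "(\<lambda>n. F n t) sums 0" for t
    proof -
      have "summable (\<lambda>n. F n t)" unfolding F_def
        by (rule summable_norm_cancel, rule cshift_summable[OF g(1) entire_type_imp_entire_at[OF g(2)]])
      then have "(\<lambda>n. F n t) sums (\<Sum>n. F n t)" by (rule summable_sums)
      then show ?thesis using zero[of "x + t *\<^sub>R axis i 1"] unfolding F_def cshift_def by simp
    qed
    \<comment> \<open>The sum \<open>G\<close> is the shifted function along the line, which is
      constantly zero by hypothesis; uniqueness of the derivative then makes the differentiated
      series vanish.\<close>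
    have "\<exists>G. \<forall>t\<in>UNIV. (\<lambda>n. F n t) sums (G t) \<and>
        (G has_derivative (\<lambda>s. s *\<^sub>R (\<Sum>n. D n t))) (at t within UNIV)"
    proof (rule has_derivative_series[where f'="\<lambda>n t s. s *\<^sub>R D n t" and x=0])
      show "(F n has_derivative (\<lambda>s. s *\<^sub>R D n t)) (at t within UNIV)" for n t
        using has_vector_derivative_divide[OF partial_deriv_line[OF smooth_dir_deriv_pow[where w=w and n=n, OF g(1)]]]
        unfolding F_def D_def has_vector_derivative_def by simp
      show "\<forall>\<^sub>F n in sequentially. \<forall>t\<in>UNIV. \<forall>s. norm ((\<Sum>i<n. s *\<^sub>R D i t) - s *\<^sub>R (\<Sum>n. D n t)) \<le> e * norm s"
        if "e > 0" for e
        using uniform_limitD[OF unif that]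
      proof eventually_elim
        case (elim n)
        have "norm ((\<Sum>i<n. s *\<^sub>R D i t) - s *\<^sub>R (\<Sum>n. D n t)) \<le> e * norm s" for s t
        proof -
          have "norm ((\<Sum>i<n. s *\<^sub>R D i t) - s *\<^sub>R (\<Sum>n. D n t)) = norm s * dist (\<Sum>i<n. D i t) (\<Sum>n. D n t)"
            by (simp add: dist_norm flip: scaleR_sum_right scaleR_diff_right)
          also have "\<dots> \<le> norm s * e"
            using elim by (intro mult_left_mono) (auto intro: less_imp_le)
          finally show ?thesis by (simp add: mult.commute)
        qed
        then show ?case by blast
      qed
    qed (use Fsums in auto)
    then obtain G where G: "\<And>t. (\<lambda>n. F n t) sums (G t)"
        "\<And>t. (G has_derivative (\<lambda>s. s *\<^sub>R (\<Sum>n. D n t))) (at t)" by auto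
    have "G = (\<lambda>_. 0)" using G(1) Fsums sums_unique2 by blast
    then have "((\<lambda>_. 0) has_derivative (\<lambda>s. s *\<^sub>R (\<Sum>n. D n 0))) (at 0)"
      using G(2)[of 0] by simp
    then have "(\<lambda>s::real. s *\<^sub>R (\<Sum>n. D n 0)) = (\<lambda>_. 0)"
      by (rule has_derivative_unique) simp
    then have "(\<Sum>n. D n 0) = 0" by (metis scaleR_one)
    moreover have "summable (\<lambda>n. D n 0)"
      by (rule summable_comparison_test'[OF sumD D_bound])
    ultimately have "(\<lambda>n. D n 0) sums 0" by (metis summable_sums)
    then show ?thesis unfolding D_def by simp
  qed
  have "(\<lambda>n. \<Sum>i\<in>UNIV. w $ i * (partial_deriv i ((dir_deriv w ^^ n) g) x / fact n)) sums (\<Sum>i\<in>UNIV. w $ i * 0)"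
    by (intro sums_sum sums_mult part)
  moreover have "(\<Sum>i\<in>UNIV. w $ i * (partial_deriv i ((dir_deriv w ^^ n) g) x / fact n)) =
      (dir_deriv w ^^ n) (dir_deriv w g) x / fact n" for n
    unfolding funpow_swap1[symmetric] by (simp add: dir_deriv_def[of w "(dir_deriv w ^^ _) g"] sum_divide_distrib)
  ultimately show ?thesis unfolding cshift_def by (simp add: sums_iff)
qed

text \<open>The coefficient form of \<open>exp(- L) (exp L) = id\<close>: a double series is summed in two ways.\<close>

lemma taylor_shift_zero:
  fixes c :: "nat \<Rightarrow> complex"
  assumes bound: "\<And>j. cmod (c j) \<le> C * (1/4) ^ j * fact j" "C \<ge> 0"
    and zero: "\<And>k. (\<Sum>n. c (n + k) / fact n) = 0"
  shows "c 0 = 0"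
proof -
  \<comment> \<open>The diagonal \<open>j\<close> collects all pairs of orders with sum
    \<open>j\<close>. Its alternating binomial sum vanishes unless \<open>j = 0\<close>, so only
    \<open>c 0\<close> survives.\<close>
  define F where "F = (\<lambda>(j, k). c j / fact j * ((-1) ^ k * of_nat (j choose k)))"
  let ?S = "Sigma UNIV (\<lambda>j::nat. {..j})"
  \<comment> \<open>Absolute values turn the alternating sum into \<open>2 ^ j\<close>; this is why
    the coefficients are assumed to have ratio 1/4.\<close>
  have nF: "(\<Sum>k\<le>j. norm (F (j, k))) = cmod (c j) / fact j * 2 ^ j" for j
  proof -
    have "(\<Sum>k\<le>j. norm (F (j, k))) = cmod (c j) / fact j * real (\<Sum>k\<le>j. j choose k)"
      unfolding F_def by (simp add: norm_mult norm_divide norm_power sum_distrib_left)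
    then show ?thesis by (simp add: choose_row_sum)
  qed
  have "(\<lambda>j. cmod (c j) / fact j * 2 ^ j) summable_on UNIV"
  proof (rule norm_summable_imp_summable_on, rule summable_comparison_test'[where N=0])
    show "summable (\<lambda>n. C * (1/2::real) ^ n)"
      by (intro summable_mult summable_geometric) simp
    fix n
    have "cmod (c n) / fact n * 2 ^ n \<le> C * (1/4) ^ n * 2 ^ n"
      using bound(1)[of n] by (intro mult_right_mono) (simp_all add: divide_le_eq)
    also have "\<dots> = C * (1/2) ^ n" by (simp add: mult.assoc flip: power_mult_distrib)
    finally show "norm (norm (cmod (c n) / fact n * 2 ^ n)) \<le> C * (1/2) ^ n" by simp
  qed
  then have abs: "(\<lambda>p. norm (F p)) summable_on ?S"
    unfolding Infinite_Sum.abs_summable_on_Sigma_iff by (simp add: nF)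
  have "infsum F ?S = (\<Sum>\<^sub>\<infinity>j. \<Sum>\<^sub>\<infinity>k\<in>{..j}. F (j, k))"
    using infsum_Sigma_banach[OF Infinite_Sum.abs_summable_summable[OF abs]] by simp
  also have "\<dots> = (\<Sum>\<^sub>\<infinity>j::nat. if j = 0 then c 0 else 0)"
  proof (rule infsum_cong)
    fix j
    have "(\<Sum>k\<le>j. F (j, k)) = c j / fact j * (\<Sum>k\<le>j. (-1) ^ k * of_nat (j choose k))"
      unfolding F_def by (simp add: sum_distrib_left)
    then show "(\<Sum>\<^sub>\<infinity>k\<in>{..j}. F (j, k)) = (if j = 0 then c 0 else 0)"
      using choose_alternating_sum[of j, where 'a=complex] by auto
  qed
  also have "\<dots> = c 0"
    using infsum_cong_neutral[of UNIV "{0::nat}" "\<lambda>j. if j = 0 then c 0 else 0" "\<lambda>j. c 0"] by simp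
  finally have total: "infsum F ?S = c 0" .
  \<comment> \<open>In the coordinates \<open>(k, n)\<close> with \<open>j = n + k\<close>, the
    inner sum over \<open>n\<close> is the \<open>k\<close>-th series assumed to vanish.\<close>
  have bij: "bij_betw (\<lambda>(k, n). (n + k, k)) (UNIV \<times> UNIV) ?S"
    by (rule bij_betwI[where g="\<lambda>(j, k). (k, j - k)"]) auto
  let ?G = "\<lambda>(k, n). (-1) ^ k / fact k * (c (n + k) / fact n)"
  have G: "?G = (\<lambda>p. F (case p of (k, n) \<Rightarrow> (n + k, k)))"
    unfolding F_def by (auto simp: fun_eq_iff binomial_fact field_simps)
  have absG: "(\<lambda>p. norm (?G p)) summable_on UNIV \<times> UNIV"
    unfolding G using summable_on_reindex_bij_betw[OF bij, of "\<lambda>p. norm (F p)"] abs by simp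
  have "c 0 = infsum ?G (UNIV \<times> UNIV)"
    unfolding G infsum_reindex_bij_betw[OF bij] total ..
  also have "\<dots> = (\<Sum>\<^sub>\<infinity>k. \<Sum>\<^sub>\<infinity>n. ?G (k, n))"
    using infsum_Sigma_banach[OF Infinite_Sum.abs_summable_summable[OF absG]] by simp
  also have "\<dots> = (\<Sum>\<^sub>\<infinity>k::nat. 0)"
  proof (rule infsum_cong)
    fix k
    have "(\<lambda>n. norm (?G (k, n))) summable_on UNIV"
      using absG unfolding Infinite_Sum.abs_summable_on_Sigma_iff by auto
    then have "(\<Sum>\<^sub>\<infinity>n. ?G (k, n)) = (\<Sum>n. ?G (k, n))"
      by (intro infsumI norm_summable_imp_has_sum)
        (auto dest: summable_on_imp_summable intro: summable_sums summable_norm_cancel)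
    also have "\<dots> = (-1) ^ k / fact k * (\<Sum>n. c (n + k) / fact n)"
    proof -
      have "summable (\<lambda>n. (-1) ^ k / fact k * (c (n + k) / fact n))"
        using \<open>(\<lambda>n. norm (?G (k, n))) summable_on UNIV\<close>
        by (auto dest!: summable_on_imp_summable intro: summable_norm_cancel)
      then have "summable (\<lambda>n. c (n + k) / fact n)"
        by (subst (asm) summable_cmult_iff) simp
      then show ?thesis by (simp only: prod.case suminf_mult)
    qed
    finally show "(\<Sum>\<^sub>\<infinity>n. ?G (k, n)) = 0" by (simp add: zero)
  qed
  finally show ?thesis by simp
qed

text \<open>Iterating \<open>cshift_dir_deriv_eq_0\<close> makes the shifts of all
  \<open>(dir_deriv w ^^ k) g\<close> vanish. At a fixed \<open>x\<close> these are the hypotheses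
  of \<open>taylor_shift_zero\<close> for the coefficients
  \<open>(dir_deriv w ^^ n) g x\<close>.\<close>

lemma cshift_inj:
  assumes g: "smooth g" "entire_type g" and zero: "\<And>x. cshift w g x = 0"
  shows "g x = 0"
proof -
  have "smooth ((dir_deriv w ^^ k) g) \<and> entire_type ((dir_deriv w ^^ k) g) \<and>
      (\<forall>x. cshift w ((dir_deriv w ^^ k) g) x = 0)" for k
    by (induction k) (use g zero cshift_dir_deriv_eq_0 entire_type_dir_deriv smooth_dir_deriv in auto)
  then have "(\<Sum>n. (dir_deriv w ^^ (n + k)) g x / fact n) = 0" for k
    unfolding cshift_def by (simp add: funpow_add)
  moreover obtain h where h: "h > 0" "wsum w * h \<le> 1/4" using small_step[of 1 "1/4" w] by auto
  moreover obtain C where C: "C \<ge> 0" "\<And>is x. cmod (pderivs is g x) \<le> C * h ^ length is * fact (length is)"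
    using entire_typeD[OF g(2) h(1)] by metis
  moreover have "cmod ((dir_deriv w ^^ j) g x) \<le> C * (1/4) ^ j * fact j" for j
  proof -
    have "cmod ((dir_deriv w ^^ j) g x / fact j) \<le> C * (wsum w * h) ^ j"
      by (rule cshift_term_bound[OF g(1) C(2)])
    also have "\<dots> \<le> C * (1/4) ^ j"
      using h C(1) by (intro mult_left_mono power_mono) (auto intro!: mult_nonneg_nonneg sum_nonneg)
    finally show ?thesis by (simp add: norm_divide divide_le_eq)
  qed
  ultimately show ?thesis
    using taylor_shift_zero[of "\<lambda>n. (dir_deriv w ^^ n) g x" C] by simp
qed

section \<open>Multi-index sums\<close>

text \<open>The derivatives commute only on smooth functions, so smoothness is carried along as an
  invariant of the fold.\<close>

lemma pderivs_permute:
  assumes "smooth f" "mset is = mset js"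
  shows "pderivs is f = pderivs js f"
  unfolding foldr_conv_fold
  by (rule fold_permuted_eq[where P=smooth])
    (use assms smooth_partial_deriv partial_deriv_commute in auto)

lemma mi_list_exists: "\<exists>is. \<forall>i. count_list is i = \<beta> $ i"
proof -
  obtain "is" where "mset is = (\<Sum>i\<in>UNIV. replicate_mset (\<beta> $ i) i)"
    using ex_mset by blast
  then have "count (mset is) i = \<beta> $ i" for i
    by (simp add: count_sum sum.delta)
  then show ?thesis by (auto simp: count_mset)
qed

text \<open>The list does not depend on \<open>f\<close>, so identities between several functions,
  such as linearity, pass from lists to multi-indices.\<close>

lemma mi_deriv_eq_pderivs:
  obtains "is" where "\<And>i. count_list is i = \<beta> $ i" "length is = mi_size \<beta>"
    "\<And>f. mi_deriv \<beta> f = pderivs is f"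
proof -
  define L where "L = (SOME is. \<forall>i. count_list is i = \<beta> $ i)"
  have L: "\<forall>i. count_list L i = \<beta> $ i"
    unfolding L_def by (rule someI_ex[OF mi_list_exists])
  then have "length L = mi_size \<beta>"
    unfolding mi_size_def using sum_count_set[of L UNIV] by simp
  with L that show ?thesis unfolding mi_deriv_def L_def by blast
qed

lemma pderivs_eq_mi_deriv:
  assumes "smooth f" "\<And>i. count_list is i = \<beta> $ i"
  shows "pderivs is f = mi_deriv \<beta> f"
proof -
  obtain js where js: "\<And>i. count_list js i = \<beta> $ i" "mi_deriv \<beta> f = pderivs js f"
    using mi_deriv_eq_pderivs by metis
  then have "mset is = mset js" using assms by (auto intro!: multiset_eqI simp: count_mset)
  then show ?thesis using pderivs_permute[OF assms(1)] js(2) by metis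
qed

lemma partial_deriv_mi_deriv:
  assumes "smooth f"
  shows "partial_deriv i (mi_deriv \<alpha> f) = mi_deriv (\<alpha> + axis i 1) f"
proof -
  obtain "is" where "is": "\<And>i. count_list is i = \<alpha> $ i" "mi_deriv \<alpha> f = pderivs is f"
    using mi_deriv_eq_pderivs by metis
  have "pderivs (i # is) f = mi_deriv (\<alpha> + axis i 1) f"
    by (rule pderivs_eq_mi_deriv[OF assms]) (auto simp: "is" axis_def)
  then show ?thesis by (simp add: "is")
qed

lemma smooth_mi_deriv: "smooth f \<Longrightarrow> smooth (mi_deriv \<alpha> f)"
  using mi_deriv_eq_pderivs smooth_pderivs by metis

lemma mi_size_add_axis: "mi_size (\<alpha> + axis i 1) = Suc (mi_size \<alpha>)"
  unfolding mi_size_def by (simp add: sum.distrib axis_def)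

lemma mi_power_add_axis: "mi_power w (\<alpha> + axis i 1) = w $ i * mi_power w \<alpha>"
proof -
  have "(\<Prod>j\<in>UNIV. (w $ j) ^ (axis i 1 $ j)) = (\<Prod>j\<in>UNIV. if j = i then w $ j else 1)"
    by (rule prod.cong) (auto simp: axis_def)
  then show ?thesis
    unfolding mi_power_def by (simp add: power_add prod.distrib mult.commute)
qed

lemma mi_fact_add_axis: "mi_fact (\<alpha> + axis i 1) = real (Suc (\<alpha> $ i)) * mi_fact \<alpha>"
proof -
  have "mi_fact (\<alpha> + axis i 1) = (\<Prod>j\<in>UNIV. (if j = i then real (Suc (\<alpha> $ j)) else 1) * fact (\<alpha> $ j))"
    unfolding mi_fact_def by (rule prod.cong) (auto simp: axis_def)
  then show ?thesis
    unfolding mi_fact_def by (simp add: prod.distrib)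
qed

lemma mi_fact_pos: "mi_fact \<alpha> > 0"
  unfolding mi_fact_def by (simp add: prod_pos)

lemma finite_mi_size: "finite {\<alpha>::'d::finite multi_index. mi_size \<alpha> = n}"
proof (rule finite_subset)
  show "{\<alpha>::'d multi_index. mi_size \<alpha> = n} \<subseteq> vec_lambda ` (Pi\<^sub>E UNIV (\<lambda>_. {..n}))"
  proof
    fix \<alpha> :: "'d multi_index" assume "\<alpha> \<in> {\<alpha>. mi_size \<alpha> = n}"
    then have "\<alpha> $ i \<le> n" for i
      unfolding mi_size_def by (auto intro: member_le_sum)
    then show "\<alpha> \<in> vec_lambda ` (Pi\<^sub>E UNIV (\<lambda>_. {..n}))"
      by (intro image_eqI[of _ _ "vec_nth \<alpha>"]) auto
  qed
qed (intro finite_imageI finite_PiE, auto)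

text \<open>The multinomial theorem for commuting derivatives. In the induction step a multi-index
  \<open>\<beta>\<close> of size \<open>n + 1\<close> receives from each direction \<open>i\<close>
  its own coefficient times \<open>\<beta> $ i\<close>, and these weights add up to
  \<open>n + 1\<close>.\<close>

lemma dir_deriv_pow_multinomial:
  assumes f: "smooth f"
  shows "(dir_deriv w ^^ n) f x / fact n =
    (\<Sum>\<alpha> | mi_size \<alpha> = n. mi_power w \<alpha> / of_real (mi_fact \<alpha>) * mi_deriv \<alpha> f x)"
proof (induction n arbitrary: x)
  case 0
  have "{\<alpha>::'a multi_index. mi_size \<alpha> = 0} = {0}"
    unfolding mi_size_def by (auto simp: vec_eq_iff)
  moreover have "mi_deriv 0 f = f"
    using pderivs_eq_mi_deriv[OF f, of "[]" 0] by simp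
  ultimately show ?case by (simp add: mi_power_def mi_fact_def)
next
  case (Suc n)
  let ?c = "\<lambda>\<alpha>. mi_power w \<alpha> / of_real (mi_fact \<alpha>)"
  let ?A = "\<lambda>n. {\<alpha>::'a multi_index. mi_size \<alpha> = n}"
  have eq: "(dir_deriv w ^^ n) f = (\<lambda>x. \<Sum>\<alpha>\<in>?A n. (fact n * ?c \<alpha>) * mi_deriv \<alpha> f x)"
    using Suc by (simp add: fun_eq_iff field_simps sum_distrib_left)
  have pd: "partial_deriv i (\<lambda>x. \<Sum>\<alpha>\<in>?A n. (fact n * ?c \<alpha>) * mi_deriv \<alpha> f x) =
     (\<lambda>x. \<Sum>\<alpha>\<in>?A n. (fact n * ?c \<alpha>) * mi_deriv (\<alpha> + axis i 1) f x)" for i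
    using pderivs_sum[where js="[i]" and I="?A n" and f="\<lambda>\<alpha>. mi_deriv \<alpha> f" and a="\<lambda>\<alpha>. fact n * ?c \<alpha>",
        OF finite_mi_size smooth_mi_deriv[OF f]]
    by (simp add: partial_deriv_mi_deriv[OF f])
  have "(dir_deriv w ^^ Suc n) f x =
     (\<Sum>i\<in>UNIV. w $ i * (\<Sum>\<alpha>\<in>?A n. (fact n * ?c \<alpha>) * mi_deriv (\<alpha> + axis i 1) f x))"
    unfolding funpow.simps comp_def eq dir_deriv_def pd ..
  also have "\<dots> = fact n * (\<Sum>i\<in>UNIV. \<Sum>\<alpha>\<in>?A n. w $ i * ?c \<alpha> * mi_deriv (\<alpha> + axis i 1) f x)"
    by (simp add: sum_distrib_left mult_ac)
  finally have eq_Suc: "(dir_deriv w ^^ Suc n) f x =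
    fact n * (\<Sum>i\<in>UNIV. \<Sum>\<alpha>\<in>?A n. w $ i * ?c \<alpha> * mi_deriv (\<alpha> + axis i 1) f x)" .
  \<comment> \<open>Adding \<open>axis i 1\<close> reaches exactly the \<open>\<beta>\<close> with
    \<open>\<beta> $ i > 0\<close>, where the truncated subtraction is its inverse. The remaining
    \<open>\<beta>\<close> may be included because their weight is zero.\<close>
  have raise: "(\<Sum>\<alpha>\<in>?A n. w $ i * ?c \<alpha> * mi_deriv (\<alpha> + axis i 1) f x) =
     (\<Sum>\<beta>\<in>?A (Suc n). of_nat (\<beta> $ i) * ?c \<beta> * mi_deriv \<beta> f x)" for i
  proof -
    have "(\<Sum>\<alpha>\<in>?A n. w $ i * ?c \<alpha> * mi_deriv (\<alpha> + axis i 1) f x) =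
      (\<Sum>\<beta>\<in>{\<beta> \<in> ?A (Suc n). \<beta> $ i > 0}. of_nat (\<beta> $ i) * ?c \<beta> * mi_deriv \<beta> f x)"
    proof (rule sum.reindex_bij_witness[where i="\<lambda>\<beta>. \<beta> - axis i 1" and j="\<lambda>\<alpha>. \<alpha> + axis i 1"])
      fix \<beta> assume "\<beta> \<in> {\<beta> \<in> ?A (Suc n). \<beta> $ i > 0}"
      then have b: "mi_size \<beta> = Suc n" "\<beta> $ i > 0" by auto
      have *: "\<beta> - axis i 1 + axis i 1 = \<beta>"
        using b(2) by (auto simp: vec_eq_iff axis_def)
      show "\<beta> - axis i 1 + axis i 1 = \<beta>" by (rule *)
      show "\<beta> - axis i 1 \<in> ?A n"
        using mi_size_add_axis[of "\<beta> - axis i 1" i] b(1) unfolding * by simp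
    next
      fix \<alpha> assume "\<alpha> \<in> ?A n"
      show "of_nat ((\<alpha> + axis i 1) $ i) * ?c (\<alpha> + axis i 1) * mi_deriv (\<alpha> + axis i 1) f x =
          w $ i * ?c \<alpha> * mi_deriv (\<alpha> + axis i 1) f x"
        unfolding mi_power_add_axis mi_fact_add_axis
        using mi_fact_pos[of \<alpha>] by (simp add: axis_def field_simps del: of_nat_Suc)
    qed (auto simp: mi_size_add_axis simp del: One_nat_def)
    also have "\<dots> = (\<Sum>\<beta>\<in>?A (Suc n). of_nat (\<beta> $ i) * ?c \<beta> * mi_deriv \<beta> f x)"
      by (rule sum.mono_neutral_left) (auto simp: finite_mi_size)
    finally show ?thesis .
  qed
  have "(\<Sum>i\<in>UNIV. \<Sum>\<beta>\<in>?A (Suc n). of_nat (\<beta> $ i) * ?c \<beta> * mi_deriv \<beta> f x) =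
     (\<Sum>\<beta>\<in>?A (Suc n). of_nat (\<Sum>i\<in>UNIV. \<beta> $ i) * ?c \<beta> * mi_deriv \<beta> f x)"
    by (subst sum.swap) (simp add: sum_distrib_right sum_divide_distrib)
  also have "\<dots> = of_nat (Suc n) * (\<Sum>\<beta>\<in>?A (Suc n). ?c \<beta> * mi_deriv \<beta> f x)"
    unfolding sum_distrib_left mi_size_def[symmetric] by (rule sum.cong) (simp_all add: mult.assoc)
  finally have "(dir_deriv w ^^ Suc n) f x =
      fact n * (of_nat (Suc n) * (\<Sum>\<beta>\<in>?A (Suc n). ?c \<beta> * mi_deriv \<beta> f x))"
    unfolding eq_Suc raise by simp
  then show ?case by (simp del: of_nat_Suc funpow.simps)
qed

text \<open>Read off from the preceding lemma applied to a plane wave with frequency \<open>(1, \<dots>, 1)\<close>,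
  all of whose derivatives at \<open>0\<close> are powers of \<open>\<i>\<close>.\<close>

lemma multinomial_sum:
  "(\<Sum>\<alpha> | mi_size \<alpha> = n. cmod (mi_power w \<alpha>) / mi_fact \<alpha>) = wsum w ^ n / fact n"
proof -
  let ?v = "\<chi> i. complex_of_real (cmod (w $ i))"
  let ?\<xi> = "\<chi> i. (1::real)"
  have d: "mi_deriv \<alpha> (plane_wave ?\<xi>) 0 = \<i> ^ mi_size \<alpha>" for \<alpha>
  proof -
    obtain "is" where "length is = mi_size \<alpha>" "mi_deriv \<alpha> (plane_wave ?\<xi>) = pderivs is (plane_wave ?\<xi>)"
      using mi_deriv_eq_pderivs by metis
    then show ?thesis by (simp add: pderivs_plane_wave map_replicate_const prod_list_replicate)
  qed
  have p: "mi_power ?v \<alpha> = of_real (cmod (mi_power w \<alpha>))" for \<alpha>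
    unfolding mi_power_def by (simp add: norm_power flip: prod_norm)
  have "\<i> ^ n * of_real (wsum w ^ n / fact n) = (dir_deriv ?v ^^ n) (plane_wave ?\<xi>) 0 / fact n"
    unfolding dir_deriv_pow_plane_wave by (simp add: power_mult_distrib)
  also have "\<dots> = (\<Sum>\<alpha> | mi_size \<alpha> = n. mi_power ?v \<alpha> / of_real (mi_fact \<alpha>) * \<i> ^ mi_size \<alpha>)"
    unfolding dir_deriv_pow_multinomial[OF smooth_plane_wave] d ..
  also have "\<dots> = \<i> ^ n * of_real (\<Sum>\<alpha> | mi_size \<alpha> = n. cmod (mi_power w \<alpha>) / mi_fact \<alpha>)"
    unfolding p by (simp add: sum_distrib_left mult.commute)
  finally have "complex_of_real (wsum w ^ n / fact n) =
      of_real (\<Sum>\<alpha> | mi_size \<alpha> = n. cmod (mi_power w \<alpha>) / mi_fact \<alpha>)"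
    by (rule mult_left_cancel[THEN iffD1, rotated]) simp
  then show ?thesis by (simp only: of_real_eq_iff)
qed

lemma bij_betw_mi_size: "bij_betw snd (Sigma UNIV (\<lambda>n. {\<alpha>. mi_size \<alpha> = n})) UNIV"
  by (rule bij_betwI[where g="\<lambda>\<alpha>. (mi_size \<alpha>, \<alpha>)"]) auto

text \<open>Summed over one size \<open>n\<close>, the factor \<open>fact n\<close> cancels the
  denominator in \<open>multinomial_sum\<close>, and a geometric series with ratio
  \<open>wsum w * q\<close> remains.\<close>

lemma mi_majorant_summable:
  assumes "q \<ge> 0" "wsum w * q \<le> 1/2"
  shows "(\<lambda>\<alpha>. cmod (mi_power w \<alpha>) / mi_fact \<alpha> * (q ^ mi_size \<alpha> * fact (mi_size \<alpha>))) summable_on UNIV"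
    (is "?M summable_on UNIV")
proof -
  have M0: "?M \<alpha> \<ge> 0" for \<alpha> using assms(1) mi_fact_pos[of \<alpha>] by simp
  have sum: "(\<Sum>\<alpha> | mi_size \<alpha> = n. ?M \<alpha>) = (wsum w * q) ^ n" for n
  proof -
    have "(\<Sum>\<alpha> | mi_size \<alpha> = n. ?M \<alpha>) =
        (\<Sum>\<alpha> | mi_size \<alpha> = n. cmod (mi_power w \<alpha>) / mi_fact \<alpha>) * (q ^ n * fact n)"
      by (simp add: sum_distrib_right)
    then show ?thesis unfolding multinomial_sum by (simp add: power_mult_distrib)
  qed
  have W: "wsum w * q \<ge> 0" using assms by (simp add: sum_nonneg)
  have nsum: "norm (\<Sum>\<^sub>\<infinity>\<alpha>\<in>{\<alpha>. mi_size \<alpha> = n}. norm (?M (snd (n, \<alpha>)))) = (wsum w * q) ^ n" for n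
    by (simp only: snd_conv infsum_finite[OF finite_mi_size] real_norm_def abs_of_nonneg[OF M0] sum
        abs_of_nonneg[OF zero_le_power[OF W]])
  have "(\<lambda>n. (wsum w * q) ^ n) summable_on UNIV"
    using W assms(2) by (intro norm_summable_imp_summable_on) (auto simp: norm_power intro!: summable_geometric)
  then have "(\<lambda>p. norm (?M (snd p))) summable_on Sigma UNIV (\<lambda>n. {\<alpha>. mi_size \<alpha> = n})"
    unfolding Infinite_Sum.abs_summable_on_Sigma_iff nsum by (simp add: finite_mi_size)
  then have "(\<lambda>p. ?M (snd p)) summable_on Sigma UNIV (\<lambda>n. {\<alpha>. mi_size \<alpha> = n})"
    by (rule Infinite_Sum.abs_summable_summable)
  then show ?thesis
    using summable_on_reindex_bij_betw[OF bij_betw_mi_size, of ?M] by simp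
qed

text \<open>Absolute convergence permits grouping by size; each group is finite and is one term of
  the exponential series by the multinomial theorem.\<close>

lemma mi_sum_eq_cshift:
  assumes f: "smooth f" "entire_at f x"
  shows "(\<Sum>\<^sub>\<infinity>\<alpha>. mi_power w \<alpha> / of_real (mi_fact \<alpha>) * mi_deriv \<alpha> f x) = cshift w f x"
proof -
  let ?T = "\<lambda>\<alpha>. mi_power w \<alpha> / of_real (mi_fact \<alpha>) * mi_deriv \<alpha> f x"
  let ?S = "Sigma UNIV (\<lambda>n. {\<alpha>::'a multi_index. mi_size \<alpha> = n})"
  obtain h where h: "h > 0" "wsum w * h \<le> 1/2" using small_step[of 1 "1/2" w] by auto
  obtain C where C: "C \<ge> 0" "\<And>is. cmod (pderivs is f x) \<le> C * h ^ length is * fact (length is)"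
    using entire_atD[OF f(2) h(1)] by metis
  have "?T summable_on UNIV"
  proof (rule Infinite_Sum.abs_summable_summable, rule Infinite_Sum.abs_summable_on_comparison_test')
    show "(\<lambda>\<alpha>. C * (cmod (mi_power w \<alpha>) / mi_fact \<alpha> * (h ^ mi_size \<alpha> * fact (mi_size \<alpha>)))) summable_on UNIV"
      using h by (intro summable_on_cmult_right mi_majorant_summable) auto
    fix \<alpha>
    have "cmod (mi_deriv \<alpha> f x) \<le> C * h ^ mi_size \<alpha> * fact (mi_size \<alpha>)"
      using mi_deriv_eq_pderivs[of \<alpha>] C(2) by metis
    then have "cmod (mi_power w \<alpha>) / mi_fact \<alpha> * cmod (mi_deriv \<alpha> f x) \<le>
        cmod (mi_power w \<alpha>) / mi_fact \<alpha> * (C * h ^ mi_size \<alpha> * fact (mi_size \<alpha>))"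
      using mi_fact_pos[of \<alpha>] by (intro mult_left_mono) auto
    then show "norm (?T \<alpha>) \<le> C * (cmod (mi_power w \<alpha>) / mi_fact \<alpha> * (h ^ mi_size \<alpha> * fact (mi_size \<alpha>)))"
      using mi_fact_pos[of \<alpha>] by (simp add: norm_mult norm_divide mult_ac)
  qed
  then have "(\<lambda>p. ?T (snd p)) summable_on ?S"
    using summable_on_reindex_bij_betw[OF bij_betw_mi_size, of ?T] by simp
  then have "(\<Sum>\<^sub>\<infinity>n. \<Sum>\<^sub>\<infinity>\<alpha>\<in>{\<alpha>. mi_size \<alpha> = n}. ?T \<alpha>) = infsum (\<lambda>p. ?T (snd p)) ?S"
    using infsum_Sigma_banach[of "\<lambda>p. ?T (snd p)"] by simp
  also have "\<dots> = infsum ?T UNIV"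
    by (rule infsum_reindex_bij_betw[OF bij_betw_mi_size])
  also have "(\<Sum>\<^sub>\<infinity>n. \<Sum>\<^sub>\<infinity>\<alpha>\<in>{\<alpha>. mi_size \<alpha> = n}. ?T \<alpha>) = (\<Sum>\<^sub>\<infinity>n. (dir_deriv w ^^ n) f x / fact n)"
    by (simp add: finite_mi_size dir_deriv_pow_multinomial[OF f(1)])
  also have "\<dots> = cshift w f x"
    unfolding cshift_def
    by (intro infsumI norm_summable_imp_has_sum cshift_summable[OF f] summable_sums
        summable_norm_cancel[OF cshift_summable[OF f]])
  finally show ?thesis ..
qed

section \<open>Gelfand--Shilov spaces\<close>

lemma gs_smooth: "f \<in> gelfand_shilov s t \<Longrightarrow> smooth f"
  unfolding gelfand_shilov_def by simp

lemma gs_quotient_le_seminorm: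
  assumes "f \<in> gelfand_shilov s t" "h > 0"
  shows "gs_quotient s t h f p \<le> gs_seminorm s t h f"
  unfolding gs_seminorm_def using assms
  by (intro cSUP_upper) (auto simp: gelfand_shilov_def)

lemma gs_quotient_nonneg: "h > 0 \<Longrightarrow> gs_quotient s t h f p \<ge> 0"
  unfolding gs_quotient_def by (auto simp: case_prod_beta intro!: divide_nonneg_nonneg)

lemma gs_seminorm_nonneg:
  "f \<in> gelfand_shilov s t \<Longrightarrow> h > 0 \<Longrightarrow> gs_seminorm s t h f \<ge> 0"
  using gs_quotient_le_seminorm gs_quotient_nonneg order_trans by blast

lemma D_op_linear:
  assumes "smooth f" "smooth g"
  shows "D_op \<beta> (\<lambda>x. a * f x + b * g x) x = a * D_op \<beta> f x + b * D_op \<beta> g x"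
proof -
  obtain "is" where "\<And>f. mi_deriv \<beta> f = pderivs is f" using mi_deriv_eq_pderivs by metis
  then show ?thesis unfolding D_op_def using pderivs_linear[OF assms] by (simp add: algebra_simps)
qed

lemma gs_linear:
  assumes "f \<in> gelfand_shilov s t" "g \<in> gelfand_shilov s t"
  shows "(\<lambda>x. a * f x + b * g x) \<in> gelfand_shilov s t"
proof -
  note S = gs_smooth[OF assms(1)] gs_smooth[OF assms(2)]
  have "bdd_above (range (gs_quotient s t h (\<lambda>x. a * f x + b * g x)))" if h: "h > 0" for h
  proof (rule bdd_aboveI2)
    fix p :: "'a multi_index \<times> 'a multi_index \<times> (real ^ 'a)"
    obtain \<alpha> \<beta> x where p: "p = (\<alpha>, \<beta>, x)" by (cases p) auto
    let ?d = "h ^ mi_size (\<alpha> + \<beta>) * mi_fact \<alpha> powr s * mi_fact \<beta> powr t"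
    let ?m = "complex_of_real (mi_power x \<alpha>)"
    have "?d \<ge> 0" using h by simp
    have "cmod (?m * (a * D_op \<beta> f x + b * D_op \<beta> g x)) =
        cmod (a * (?m * D_op \<beta> f x) + b * (?m * D_op \<beta> g x))"
      by (simp add: algebra_simps)
    also have "\<dots> \<le> cmod a * cmod (?m * D_op \<beta> f x) + cmod b * cmod (?m * D_op \<beta> g x)"
      by (metis norm_mult norm_triangle_ineq)
    finally have "gs_quotient s t h (\<lambda>x. a * f x + b * g x) p \<le>
        (cmod a * cmod (?m * D_op \<beta> f x) + cmod b * cmod (?m * D_op \<beta> g x)) / ?d"
      unfolding gs_quotient_def p prod.case D_op_linear[OF S] using \<open>?d \<ge> 0\<close> by (rule divide_right_mono)
    also have "\<dots> = cmod a * gs_quotient s t h f p + cmod b * gs_quotient s t h g p"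
      unfolding gs_quotient_def p prod.case by (simp add: add_divide_distrib)
    also have "\<dots> \<le> cmod a * gs_seminorm s t h f + cmod b * gs_seminorm s t h g"
      using assms h by (intro add_mono mult_left_mono gs_quotient_le_seminorm) auto
    finally show "gs_quotient s t h (\<lambda>x. a * f x + b * g x) p \<le>
        cmod a * gs_seminorm s t h f + cmod b * gs_seminorm s t h g" .
  qed
  then show ?thesis
    unfolding gelfand_shilov_def using smooth_linear[OF S] by simp
qed

lemma gs_diff:
  "f \<in> gelfand_shilov s t \<Longrightarrow> g \<in> gelfand_shilov s t \<Longrightarrow> (\<lambda>x. f x - g x) \<in> gelfand_shilov s t"
  using gs_linear[of f s t g 1 "-1"] by simp

lemma gs_cmult: "f \<in> gelfand_shilov s t \<Longrightarrow> (\<lambda>x. c * f x) \<in> gelfand_shilov s t"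
  using gs_linear[of f s t f c 0] by simp

lemma gs_seminorm_zero: "gs_seminorm s t h (\<lambda>_::real ^ 'd::finite. 0) = 0"
proof -
  have "mi_deriv \<beta> (\<lambda>_. 0) = (\<lambda>_. 0)" for \<beta> :: "'d multi_index"
    unfolding mi_deriv_def by (rule pderivs_zero)
  then have "gs_quotient s t h (\<lambda>_::real^'d. 0) p = 0" for p
    unfolding gs_quotient_def D_op_def by (simp add: case_prod_beta)
  then show ?thesis unfolding gs_seminorm_def by simp
qed

section \<open>Continuity and convergence of functionals\<close>

lemma topspace_gs_topology: "topspace (gs_topology s t) = gelfand_shilov s t"
proof -
  let ?S = "{{g \<in> gelfand_shilov s t. gs_seminorm s t h (\<lambda>x. g x - f x) < \<epsilon>} | f h \<epsilon>.
        f \<in> gelfand_shilov s t \<and> h > 0 \<and> \<epsilon> > 0} :: (real ^ 'a \<Rightarrow> complex) set set"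
  have "gelfand_shilov s t \<subseteq> \<Union>?S"
  proof (intro subsetI UnionI)
    fix f :: "real ^ 'a \<Rightarrow> complex"
    assume f: "f \<in> gelfand_shilov s t"
    then show "{g \<in> gelfand_shilov s t. gs_seminorm s t 1 (\<lambda>x. g x - f x) < 1} \<in> ?S"
      using zero_less_one by blast
    show "f \<in> {g \<in> gelfand_shilov s t. gs_seminorm s t 1 (\<lambda>x. g x - f x) < 1}"
      using f by (simp add: gs_seminorm_zero)
  qed
  moreover have "\<Union>?S \<subseteq> gelfand_shilov s t" by auto
  ultimately show ?thesis
    unfolding gs_topology_def topology_generated_by_topspace by (rule subset_antisym[rotated])
qed

lemma gs_dualI:
  assumes add: "\<And>\<phi> \<eta>. \<phi> \<in> gelfand_shilov s t \<Longrightarrow> \<eta> \<in> gelfand_shilov s t \<Longrightarrow>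
      v (\<lambda>x. \<phi> x + \<eta> x) = v \<phi> + v \<eta>"
    and cmult: "\<And>c \<phi>. \<phi> \<in> gelfand_shilov s t \<Longrightarrow> v (\<lambda>x. c * \<phi> x) = cnj c * v \<phi>"
    and bound: "\<And>\<phi>. \<phi> \<in> gelfand_shilov s t \<Longrightarrow> cmod (v \<phi>) \<le> gs_seminorm s t h \<phi> * K"
    and h: "h > 0" and K: "K \<ge> 0"
  shows "v \<in> gs_dual s t"
proof -
  let ?G = "gelfand_shilov s t"
  have diff: "v (\<lambda>x. g x - f x) = v g - v f" if "f \<in> ?G" "g \<in> ?G" for f g
    using add[OF that(2) gs_cmult[OF that(1), of "-1"]] cmult[OF that(1), of "-1"] by simp
  have "openin (gs_topology s t) {x \<in> ?G. v x \<in> U}" if U: "open U" for U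
  proof (subst openin_subopen, intro ballI)
    fix f assume "f \<in> {x \<in> ?G. v x \<in> U}"
    then have f: "f \<in> ?G" "v f \<in> U" by auto
    obtain e where e: "e > 0" "\<And>y. dist y (v f) < e \<Longrightarrow> y \<in> U"
      using U f(2) unfolding open_dist by blast
    \<comment> \<open>The \<open>+ 1\<close> covers \<open>K = 0\<close> and makes the final
      estimate strict.\<close>
    let ?e = "e / (K + 1)"
    let ?T = "{g \<in> ?G. gs_seminorm s t h (\<lambda>x. g x - f x) < ?e}"
    have e': "?e > 0" using e(1) K by simp
    have "openin (gs_topology s t) ?T"
      unfolding gs_topology_def openin_topology_generated_by_iff
      using f(1) h e' by (intro generate_topology_on.Basis) blast
    moreover have "f \<in> ?T" using f(1) e' by (simp add: gs_seminorm_zero)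
    moreover have "?T \<subseteq> {x \<in> ?G. v x \<in> U}"
    proof
      fix g assume g: "g \<in> ?T"
      have "cmod (v g - v f) \<le> gs_seminorm s t h (\<lambda>x. g x - f x) * K"
        using bound[OF gs_diff, of g f] diff[of f g] f(1) g by simp
      also have "\<dots> \<le> ?e * K" using g K by (intro mult_right_mono) auto
      also have "\<dots> < e" using e(1) K by (simp add: field_simps)
      finally show "g \<in> {x \<in> ?G. v x \<in> U}" using g e(2) by (simp add: dist_norm)
    qed
    ultimately show "\<exists>T. openin (gs_topology s t) T \<and> f \<in> T \<and> T \<subseteq> {x \<in> ?G. v x \<in> U}" by blast
  qed
  then have "continuous_map (gs_topology s t) euclidean v"
    unfolding continuous_map_def topspace_gs_topology by simp
  then show ?thesis unfolding gs_dual_def using add cmult by blast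
qed

text \<open>Eventual membership survives finite intersections and arbitrary unions, so it suffices
  to test the generating sets. The first assumption puts the limit into the underlying
  space.\<close>

lemma limitin_generated_topology:
  assumes "l \<in> \<Union>S" and "\<And>U. U \<in> S \<Longrightarrow> l \<in> U \<Longrightarrow> eventually (\<lambda>x. f x \<in> U) F"
  shows "limitin (topology_generated_by S) f l F"
proof -
  have "l \<in> U \<Longrightarrow> eventually (\<lambda>x. f x \<in> U) F" if "generate_topology_on S U" for U
    using that
  proof induction
    case (Int a b)
    then show ?case by (auto intro: eventually_conj elim: eventually_mono)
  next
    case (UN K)
    then obtain k where "k \<in> K" "l \<in> k" by blast
    then show ?case using UN.IH[of k] by (auto elim: eventually_mono)
  qed (use assms(2) in auto)
  then show ?thesis
    unfolding limitin_def topology_generated_by_topspace openin_topology_generated_by_iff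
    using assms(1) by blast
qed

lemma limitin_gs_dual:
  assumes v: "v \<in> gs_dual s t" and V: "\<And>x. V x \<in> gs_dual s t"
    and unif: "\<And>B. gs_bounded s t B \<Longrightarrow> uniform_limit B V v F"
  shows "limitin (gs_dual_topology s t) V v F"
  unfolding gs_dual_topology_def
proof (rule limitin_generated_topology)
  \<comment> \<open>The empty bounded set yields the whole dual as a generating set, so the limit
    lies in the underlying space.\<close>
  have "gs_bounded s t {}" unfolding gs_bounded_def by simp
  moreover have "v \<in> {v' \<in> gs_dual s t. \<exists>\<delta><1. \<forall>\<phi>\<in>{}. cmod (v' \<phi> - v \<phi>) \<le> \<delta>}"
    using v by (auto intro: exI[of _ 0])
  ultimately show "v \<in> \<Union> {{v \<in> gs_dual s t. \<exists>\<delta><\<epsilon>. \<forall>\<phi>\<in>B. cmod (v \<phi> - u \<phi>) \<le> \<delta>} | u B \<epsilon>.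
      u \<in> gs_dual s t \<and> gs_bounded s t B \<and> \<epsilon> > 0}"
    using v zero_less_one by blast
next
  fix U
  assume "U \<in> {{v \<in> gs_dual s t. \<exists>\<delta><\<epsilon>. \<forall>\<phi>\<in>B. cmod (v \<phi> - u \<phi>) \<le> \<delta>} | u B \<epsilon>.
      u \<in> gs_dual s t \<and> gs_bounded s t B \<and> \<epsilon> > 0}" and "v \<in> U"
  then obtain u B \<epsilon> \<delta> where U: "U = {v \<in> gs_dual s t. \<exists>\<delta><\<epsilon>. \<forall>\<phi>\<in>B. cmod (v \<phi> - u \<phi>) \<le> \<delta>}"
    and B: "gs_bounded s t B" and d: "\<delta> < \<epsilon>" "\<forall>\<phi>\<in>B. cmod (v \<phi> - u \<phi>) \<le> \<delta>" by blast
  \<comment> \<open>The generating set is centred at some \<open>u\<close>, not at the limit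
    \<open>v\<close>. Half of the slack left by \<open>v\<close> is used for the approximation; the
    other half keeps the supremum strictly below \<open>\<epsilon>\<close>.\<close>
  have "(\<epsilon> - \<delta>) / 2 > 0" using d(1) by simp
  from uniform_limitD[OF unif[OF B] this] show "\<forall>\<^sub>F x in F. V x \<in> U"
  proof eventually_elim
    case (elim x)
    have "cmod (V x \<phi> - u \<phi>) \<le> (\<epsilon> + \<delta>) / 2" if "\<phi> \<in> B" for \<phi>
    proof -
      have "cmod (V x \<phi> - u \<phi>) \<le> cmod (V x \<phi> - v \<phi>) + cmod (v \<phi> - u \<phi>)"
        by (metis diff_add_cancel add_diff_eq norm_triangle_ineq)
      also have "\<dots> \<le> (\<epsilon> - \<delta>) / 2 + \<delta>"
        using elim d(2) that by (intro add_mono) (auto simp: dist_norm intro: less_imp_le)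
      finally show ?thesis by (simp add: field_simps)
    qed
    then show ?case unfolding U using V d(1) by (auto intro!: exI[of _ "(\<epsilon> + \<delta>) / 2"])
  qed
qed

section \<open>Analytic bounds and decay of test functions\<close>

lemma mi_fact_ge_1: "mi_fact \<beta> \<ge> 1"
  unfolding mi_fact_def by (intro prod_ge_1) auto

lemma mi_fact_le_fact: "mi_fact \<beta> \<le> fact (mi_size \<beta>)"
proof -
  have "(\<Prod>i\<in>A. fact (\<beta> $ i)) \<le> (fact (\<Sum>i\<in>A. \<beta> $ i) :: nat)" if "finite A" for A
    using that
  proof induction
    case (insert i A)
    then have "(\<Prod>i\<in>insert i A. fact (\<beta> $ i)) \<le> fact (\<beta> $ i) * (fact (\<Sum>i\<in>A. \<beta> $ i) :: nat)"
      by simp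
    also have "\<dots> \<le> fact (\<beta> $ i + (\<Sum>i\<in>A. \<beta> $ i))"
      by (rule dvd_imp_le[OF fact_fact_dvd_fact]) simp
    finally show ?case using insert by simp
  qed simp
  from this[of UNIV] have "real (\<Prod>i\<in>UNIV. fact (\<beta> $ i)) \<le> real (fact (\<Sum>i\<in>UNIV. \<beta> $ i))"
    by (simp only: of_nat_le_iff finite)
  then show ?thesis unfolding mi_fact_def mi_size_def by simp
qed

text \<open>Here \<open>t \<le> 1\<close> gives analyticity: the power
  \<open>mi_fact \<beta> powr t\<close> is at most \<open>mi_fact \<beta>\<close>, hence at most
  \<open>fact (mi_size \<beta>)\<close>. Among the monomials only powers of one coordinate are kept,
  encoded as \<open>axis i k\<close>; they are enough to measure decay.\<close>

lemma gs_mi_deriv_bound: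
  assumes f: "f \<in> gelfand_shilov s t" and h: "h > 0" and t: "0 < t" "t \<le> 1"
  shows "\<bar>x $ i\<bar> ^ k * cmod (mi_deriv \<beta> f x) \<le>
    gs_seminorm s t h f * (h ^ k * fact k powr s) * (h ^ mi_size \<beta> * fact (mi_size \<beta>))"
proof -
  let ?\<alpha> = "axis i k"
  have \<alpha>: "mi_size (?\<alpha> + \<beta>) = k + mi_size \<beta>" "mi_fact ?\<alpha> = fact k" "mi_power x ?\<alpha> = (x $ i) ^ k"
  proof -
    show "mi_size (?\<alpha> + \<beta>) = k + mi_size \<beta>"
      unfolding mi_size_def by (simp add: sum.distrib axis_def)
    have "mi_fact ?\<alpha> = (\<Prod>j\<in>UNIV. if j = i then fact k else 1)"
      unfolding mi_fact_def by (rule prod.cong) (auto simp: axis_def)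
    then show "mi_fact ?\<alpha> = fact k" by simp
    have "mi_power x ?\<alpha> = (\<Prod>j\<in>UNIV. if j = i then (x $ j) ^ k else 1)"
      unfolding mi_power_def by (rule prod.cong) (auto simp: axis_def)
    then show "mi_power x ?\<alpha> = (x $ i) ^ k" by simp
  qed
  let ?d = "h ^ (k + mi_size \<beta>) * fact k powr s * mi_fact \<beta> powr t"
  have d: "?d > 0" using h mi_fact_pos[of \<beta>] by simp
  have "\<bar>x $ i\<bar> ^ k * cmod (mi_deriv \<beta> f x) = cmod (of_real (mi_power x ?\<alpha>) * D_op \<beta> f x)"
    unfolding D_op_def \<alpha> by (simp add: norm_mult norm_power)
  also have "\<dots> \<le> gs_seminorm s t h f * ?d"
    using gs_quotient_le_seminorm[OF f h, of "(?\<alpha>, \<beta>, x)"] d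
    unfolding gs_quotient_def prod.case \<alpha> by (simp add: pos_divide_le_eq)
  also have "\<dots> \<le> gs_seminorm s t h f * (h ^ (k + mi_size \<beta>) * fact k powr s * fact (mi_size \<beta>))"
  proof -
    have "mi_fact \<beta> powr t \<le> mi_fact \<beta> powr 1"
      using t mi_fact_ge_1[of \<beta>] by (intro powr_mono) auto
    also have "\<dots> \<le> fact (mi_size \<beta>)" using mi_fact_le_fact[of \<beta>] mi_fact_pos[of \<beta>] by simp
    finally show ?thesis
      using h gs_seminorm_nonneg[OF f h] by (intro mult_left_mono) auto
  qed
  finally show ?thesis by (simp add: power_add mult_ac)
qed

lemma gs_pderivs_bound:
  assumes f: "f \<in> gelfand_shilov s t" and h: "h > 0" and t: "0 < t" "t \<le> 1"
  shows "\<bar>x $ i\<bar> ^ k * cmod (pderivs js f x) \<le>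
    gs_seminorm s t h f * (h ^ k * fact k powr s) * (h ^ length js * fact (length js))"
proof -
  let ?\<beta> = "\<chi> i. count_list js i"
  have "pderivs js f = mi_deriv ?\<beta> f"
    by (rule pderivs_eq_mi_deriv[OF gs_smooth[OF f]]) simp
  moreover have "mi_size ?\<beta> = length js"
    unfolding mi_size_def using sum_count_set[of js UNIV] by simp
  ultimately show ?thesis using gs_mi_deriv_bound[OF assms, of x i k ?\<beta>] by simp
qed

lemma gs_entire_type:
  assumes f: "f \<in> gelfand_shilov s t" and t: "0 < t" "t \<le> 1"
  shows "entire_type f"
  unfolding entire_type_def
proof (intro allI impI)
  fix h :: real assume "h > 0"
  from gs_pderivs_bound[where k=0, OF f this t]
  show "\<exists>C. \<forall>is x. cmod (pderivs is f x) \<le> C * h ^ length is * fact (length is)"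
    by (auto intro!: exI[of _ "gs_seminorm s t h f"] simp: mult_ac)
qed

text \<open>The factor 2 is the sum of the geometric series with ratio 1/2.\<close>

lemma cshift_bound:
  assumes "smooth f" "\<And>is. cmod (pderivs is f x) \<le> C * h ^ length is * fact (length is)"
    and h: "h > 0" "wsum w * h \<le> 1/2" and C: "C \<ge> 0"
  shows "cmod (cshift w f x) \<le> 2 * C"
proof -
  have le: "norm ((dir_deriv w ^^ n) f x / fact n) \<le> C * (1/2) ^ n" for n
  proof -
    have "norm ((dir_deriv w ^^ n) f x / fact n) \<le> C * (wsum w * h) ^ n"
      by (rule cshift_term_bound[OF assms(1,2)])
    also have "\<dots> \<le> C * (1/2) ^ n"
      using h C by (intro mult_left_mono power_mono) (auto intro!: mult_nonneg_nonneg sum_nonneg)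
    finally show ?thesis .
  qed
  have "(\<lambda>n. C * (1/2::real) ^ n) sums (C * (1 / (1 - 1/2)))"
    by (intro sums_mult geometric_sums) simp
  then have "(\<lambda>n. C * (1/2::real) ^ n) sums (2 * C)" by (simp add: mult.commute)
  then show ?thesis
    unfolding cshift_def
    by (subst sums_unique) (auto intro: norm_suminf_le[OF le] sums_summable)
qed

text \<open>With \<open>v = (y / h) powr (1/s)\<close>, taking the \<open>s\<close>-th root of the
  moment bounds gives \<open>v ^ k / fact k \<le> R\<close> for all \<open>k\<close>. Halving
  \<open>v\<close> makes the exponential series geometric, so
  \<open>exp (v / 2) \<le> 2 * R\<close>; the \<open>s\<close>-th power returns to the original
  quantities.\<close>

lemma moments_imp_exp_decay:
  fixes y T A h s :: real
  assumes y: "y > 0" and s: "s > 0" and h: "h > 0"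
    and T: "T \<ge> 0" and A: "A \<ge> 0"
    and mom: "\<And>k. y ^ k * T \<le> A * (h ^ k * fact k powr s)"
  shows "T * exp (s * (y / h) powr (1/s) / 2) \<le> 2 powr s * A"
proof (cases "T = 0")
  case False
  then have T: "T > 0" using T by simp
  define v where "v = (y / h) powr (1/s)"
  define R where "R = (A / T) powr (1/s)"
  have v: "v > 0" unfolding v_def using y h by simp
  have le: "v ^ k / fact k \<le> R" for k
  proof -
    have "(v ^ k) powr s = (y / h) ^ k"
      unfolding v_def using y h s by (simp add: powr_realpow[symmetric] powr_powr)
    then have "(v ^ k / fact k) powr s = (y / h) ^ k / fact k powr s"
      using v by (simp add: powr_divide)
    also have "\<dots> \<le> A / T"
      using mom[of k] T h by (simp add: field_simps)
    finally have "((v ^ k / fact k) powr s) powr (1/s) \<le> R"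
      unfolding R_def using s by (intro powr_mono2) auto
    then show ?thesis using s v by (simp add: powr_powr)
  qed
  have "exp (v / 2) = (\<Sum>k. (v / 2) ^ k /\<^sub>R fact k)" by (simp add: exp_def)
  also have "\<dots> \<le> (\<Sum>k. R * (1/2) ^ k)"
  proof (rule suminf_le)
    show "(v / 2) ^ k /\<^sub>R fact k \<le> R * (1/2) ^ k" for k
      using mult_right_mono[OF le[of k], of "(1/2) ^ k"] by (simp add: power_divide field_simps)
  next
    show "summable (\<lambda>k. (v / 2) ^ k /\<^sub>R fact k)" by (rule summable_exp_generic)
  qed (intro summable_mult summable_geometric, simp)
  also have "\<dots> = 2 * R" by (simp add: suminf_mult suminf_geometric summable_geometric)
  finally have "exp (v / 2) powr s \<le> (2 * R) powr s" using s by (intro powr_mono2) auto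
  also have "\<dots> = 2 powr s * (A / T)"
    unfolding R_def using s A T by (simp add: powr_mult powr_powr)
  finally have "exp (v / 2) powr s * T \<le> 2 powr s * A" using T by (simp add: field_simps)
  moreover have "exp (v / 2) powr s = exp (s * v / 2)" by (simp add: powr_def)
  ultimately show ?thesis unfolding v_def by (simp add: mult.commute)
qed (use A in simp)

text \<open>At a fixed \<open>x\<close>, each weighted bound on \<open>f\<close> is a derivative
  bound whose constant is divided by a power of the coordinate. The shift therefore inherits all
  moments of \<open>f\<close>, at the price of a factor 2, and the rate of decay grows without bound
  as \<open>h\<close> tends to 0.\<close>

lemma gs_cshift_decay:
  assumes f: "f \<in> gelfand_shilov s t" and t: "0 < t" "t \<le> 1" and s: "s > 0"
    and h: "h > 0" "wsum w * h \<le> 1/2" and x: "x $ i \<noteq> 0"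
  shows "cmod (cshift w f x) * exp (s * (\<bar>x $ i\<bar> / h) powr (1/s) / 2) \<le>
    2 powr s * (2 * gs_seminorm s t h f)"
proof (rule moments_imp_exp_decay)
  fix k
  let ?S = "gs_seminorm s t h f * (h ^ k * fact k powr s)"
  have S: "?S \<ge> 0" using h(1) gs_seminorm_nonneg[OF f h(1)] by simp
  have "cmod (cshift w f x) \<le> 2 * (?S / \<bar>x $ i\<bar> ^ k)"
  proof (rule cshift_bound[OF gs_smooth[OF f] _ h])
    show "cmod (pderivs is f x) \<le> ?S / \<bar>x $ i\<bar> ^ k * h ^ length is * fact (length is)" for "is"
      using gs_pderivs_bound[OF f h(1) t, of x i k "is"] x by (simp add: field_simps)
  qed (use S in simp)
  then show "\<bar>x $ i\<bar> ^ k * cmod (cshift w f x) \<le> 2 * gs_seminorm s t h f * (h ^ k * fact k powr s)"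
    using x by (simp add: field_simps)
qed (use s h x gs_seminorm_nonneg[OF f h(1)] in auto)

section \<open>The Dirac series and its wave front set\<close>

definition dirac_term :: "complex ^ 'd::finite \<Rightarrow> 'd multi_index \<Rightarrow> 'd functional" where
  "dirac_term z \<alpha> = (\<lambda>\<phi>. mi_power z \<alpha> / of_real (mi_fact \<alpha>) * neg_D_dist \<alpha> dirac \<phi>)"

definition dirac_series :: "complex ^ 'd::finite \<Rightarrow> 'd functional" where
  "dirac_series z = (\<lambda>\<phi>. \<Sum>\<^sub>\<infinity>\<alpha>\<in>UNIV. dirac_term z \<alpha> \<phi>)"

definition imag_shift :: "complex ^ 'd::finite \<Rightarrow> complex ^ 'd" where
  "imag_shift z = (\<chi> i. \<i> * cnj (z $ i))"

lemma dirac_term_linear: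
  assumes "smooth \<phi>" "smooth \<eta>"
  shows "dirac_term z \<alpha> (\<lambda>x. a * \<phi> x + b * \<eta> x) = cnj a * dirac_term z \<alpha> \<phi> + cnj b * dirac_term z \<alpha> \<eta>"
  unfolding dirac_term_def neg_D_dist_def D_dist_def dirac_def D_op_linear[OF assms]
  by (simp add: algebra_simps add_divide_distrib)

text \<open>The signs of \<open>neg_D_dist\<close> and \<open>D_op\<close> combine to
  \<open>(-1) * (- \<i>) = \<i>\<close>, and pulling the conjugation out of the whole term puts it
  on \<open>z\<close>.\<close>

lemma dirac_term_eq:
  "dirac_term z \<alpha> \<phi> = cnj (mi_power (imag_shift z) \<alpha> / of_real (mi_fact \<alpha>) * mi_deriv \<alpha> \<phi> 0)"
proof -
  have "mi_power (imag_shift z) \<alpha> = \<i> ^ mi_size \<alpha> * cnj (mi_power z \<alpha>)"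
    unfolding mi_power_def imag_shift_def mi_size_def
    by (simp add: power_mult_distrib prod.distrib power_sum)
  then show ?thesis
    unfolding dirac_term_def neg_D_dist_def D_dist_def dirac_def D_op_def
    by (simp flip: power_mult_distrib)
qed

lemma dirac_term_bound:
  assumes \<phi>: "\<phi> \<in> gelfand_shilov s t" and t: "0 < t" "t \<le> 1" and h: "h > 0"
  shows "cmod (dirac_term z \<alpha> \<phi>) \<le> gs_seminorm s t h \<phi> *
    (cmod (mi_power (imag_shift z) \<alpha>) / mi_fact \<alpha> * (h ^ mi_size \<alpha> * fact (mi_size \<alpha>)))"
proof -
  have "cmod (dirac_term z \<alpha> \<phi>) = cmod (mi_power (imag_shift z) \<alpha>) / mi_fact \<alpha> * cmod (mi_deriv \<alpha> \<phi> 0)"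
    unfolding dirac_term_eq complex_mod_cnj using mi_fact_pos[of \<alpha>] by (simp add: norm_mult norm_divide)
  \<comment> \<open>At the origin with exponent \<open>k = 0\<close> the coordinate factor is
    \<open>0 ^ 0 = 1\<close>, so any coordinate will do, hence \<open>undefined\<close>.\<close>
  also have "\<dots> \<le> cmod (mi_power (imag_shift z) \<alpha>) / mi_fact \<alpha> *
      (gs_seminorm s t h \<phi> * (h ^ mi_size \<alpha> * fact (mi_size \<alpha>)))"
    using gs_mi_deriv_bound[OF \<phi> h t, of 0 undefined 0 \<alpha>] mi_fact_pos[of \<alpha>]
    by (intro mult_left_mono) auto
  finally show ?thesis by (simp add: mult_ac)
qed

lemma dirac_series_eq_cshift:
  assumes "smooth \<phi>" "entire_at \<phi> 0"
  shows "dirac_series z \<phi> = cnj (cshift (imag_shift z) \<phi> 0)"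
  unfolding dirac_series_def dirac_term_eq infsum_cnj mi_sum_eq_cshift[OF assms] ..

section \<open>Convergence of the Dirac series in the dual\<close>

context
  fixes s t h :: real and z :: "complex ^ 'd::finite" and M :: "'d multi_index \<Rightarrow> real"
  assumes t: "0 < t" "t \<le> 1" and h: "h > 0" "wsum (imag_shift z) * h \<le> 1/2"
  defines "M \<equiv> \<lambda>\<alpha>. cmod (mi_power (imag_shift z) \<alpha>) / mi_fact \<alpha> * (h ^ mi_size \<alpha> * fact (mi_size \<alpha>))"
begin

lemma majorant_summable: "M summable_on UNIV"
  unfolding M_def using h by (intro mi_majorant_summable) auto

lemma majorant_nonneg: "M \<alpha> \<ge> 0"
  unfolding M_def using mi_fact_pos[of \<alpha>] h by simp

lemma dirac_term_le_majorant: "\<phi> \<in> gelfand_shilov s t \<Longrightarrow> cmod (dirac_term z \<alpha> \<phi>) \<le> gs_seminorm s t h \<phi> * M \<alpha>"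
  unfolding M_def by (rule dirac_term_bound[OF _ t h(1)])

lemma dirac_term_abs_summable:
  "\<phi> \<in> gelfand_shilov s t \<Longrightarrow> (\<lambda>\<alpha>. norm (dirac_term z \<alpha> \<phi>)) summable_on UNIV"
  by (rule Infinite_Sum.abs_summable_on_comparison_test'[OF summable_on_cmult_right[OF majorant_summable] dirac_term_le_majorant])

lemma dirac_partial_sum_dual: "(\<lambda>\<phi>. \<Sum>\<alpha>\<in>F. dirac_term z \<alpha> \<phi>) \<in> gs_dual s t"
proof (rule gs_dualI[where h=h and K="\<Sum>\<alpha>\<in>F. M \<alpha>"])
  fix \<phi> :: "real ^ 'd \<Rightarrow> complex" assume "\<phi> \<in> gelfand_shilov s t"
  then show "cmod (\<Sum>\<alpha>\<in>F. dirac_term z \<alpha> \<phi>) \<le> gs_seminorm s t h \<phi> * (\<Sum>\<alpha>\<in>F. M \<alpha>)"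
    unfolding sum_distrib_left by (intro sum_norm_le dirac_term_le_majorant)
next
  fix \<phi> \<eta> :: "real ^ 'd \<Rightarrow> complex" assume "\<phi> \<in> gelfand_shilov s t" "\<eta> \<in> gelfand_shilov s t"
  then show "(\<Sum>\<alpha>\<in>F. dirac_term z \<alpha> (\<lambda>x. \<phi> x + \<eta> x)) = (\<Sum>\<alpha>\<in>F. dirac_term z \<alpha> \<phi>) + (\<Sum>\<alpha>\<in>F. dirac_term z \<alpha> \<eta>)"
    using dirac_term_linear[of \<phi> \<eta> z _ 1 1] by (simp add: gs_smooth sum.distrib)
next
  fix c and \<phi> :: "real ^ 'd \<Rightarrow> complex" assume "\<phi> \<in> gelfand_shilov s t"
  then show "(\<Sum>\<alpha>\<in>F. dirac_term z \<alpha> (\<lambda>x. c * \<phi> x)) = cnj c * (\<Sum>\<alpha>\<in>F. dirac_term z \<alpha> \<phi>)"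
    using dirac_term_linear[of \<phi> \<phi> z _ c 0] by (simp add: gs_smooth sum_distrib_left)
qed (use h in \<open>auto intro: sum_nonneg majorant_nonneg\<close>)

lemma dirac_series_dual: "dirac_series z \<in> gs_dual s t"
proof (rule gs_dualI[where h=h and K="infsum M UNIV"])
  fix \<phi> :: "real ^ 'd \<Rightarrow> complex" assume \<phi>: "\<phi> \<in> gelfand_shilov s t"
  have "cmod (dirac_series z \<phi>) \<le> (\<Sum>\<^sub>\<infinity>\<alpha>\<in>UNIV. norm (dirac_term z \<alpha> \<phi>))"
    unfolding dirac_series_def by (rule norm_infsum_bound[OF dirac_term_abs_summable[OF \<phi>]])
  also have "\<dots> \<le> (\<Sum>\<^sub>\<infinity>\<alpha>\<in>UNIV. gs_seminorm s t h \<phi> * M \<alpha>)"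
    by (intro infsum_mono dirac_term_abs_summable \<phi> dirac_term_le_majorant summable_on_cmult_right majorant_summable)
  also have "\<dots> = gs_seminorm s t h \<phi> * infsum M UNIV"
    by (rule infsum_cmult_right[OF majorant_summable])
  finally show "cmod (dirac_series z \<phi>) \<le> gs_seminorm s t h \<phi> * infsum M UNIV" .
next
  fix \<phi> \<eta> :: "real ^ 'd \<Rightarrow> complex" assume "\<phi> \<in> gelfand_shilov s t" "\<eta> \<in> gelfand_shilov s t"
  then show "dirac_series z (\<lambda>x. \<phi> x + \<eta> x) = dirac_series z \<phi> + dirac_series z \<eta>"
    using dirac_term_linear[of \<phi> \<eta> z _ 1 1] unfolding dirac_series_def
    by (simp add: gs_smooth infsum_add Infinite_Sum.abs_summable_summable dirac_term_abs_summable)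
next
  fix c and \<phi> :: "real ^ 'd \<Rightarrow> complex" assume "\<phi> \<in> gelfand_shilov s t"
  then show "dirac_series z (\<lambda>x. c * \<phi> x) = cnj c * dirac_series z \<phi>"
    using dirac_term_linear[of \<phi> \<phi> z _ c 0] unfolding dirac_series_def
    by (simp add: gs_smooth infsum_cmult_right')
qed (use h in \<open>auto intro: infsum_nonneg majorant_nonneg\<close>)

text \<open>A bounded set has a common bound \<open>C\<close> for the one seminorm that controls all
  terms, so \<open>C * M\<close> is a Weierstrass majorant on it. The limit is along finite sets of
  multi-indices, that is, independent of any enumeration.\<close>

lemma dirac_series_limit:
  "limitin (gs_dual_topology s t) (\<lambda>F \<phi>. \<Sum>\<alpha>\<in>F. dirac_term z \<alpha> \<phi>) (dirac_series z)
    (finite_subsets_at_top UNIV)"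
proof (rule limitin_gs_dual[OF dirac_series_dual dirac_partial_sum_dual])
  fix B :: "(real ^ 'd \<Rightarrow> complex) set"
  assume B: "gs_bounded s t B"
  then obtain C where C: "\<And>\<phi>. \<phi> \<in> B \<Longrightarrow> gs_seminorm s t h \<phi> \<le> C"
    using h(1) unfolding gs_bounded_def bdd_above_def by (metis imageI)
  have "norm (dirac_term z \<alpha> \<phi>) \<le> C * M \<alpha>" if "\<phi> \<in> B" for \<alpha> \<phi>
  proof -
    have "norm (dirac_term z \<alpha> \<phi>) \<le> gs_seminorm s t h \<phi> * M \<alpha>"
      using that B by (intro dirac_term_le_majorant) (auto simp: gs_bounded_def)
    also have "\<dots> \<le> C * M \<alpha>" by (rule mult_right_mono[OF C[OF that] majorant_nonneg])
    finally show ?thesis .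
  qed
  then show "uniform_limit B (\<lambda>F \<phi>. \<Sum>\<alpha>\<in>F. dirac_term z \<alpha> \<phi>) (dirac_series z) (finite_subsets_at_top UNIV)"
    unfolding dirac_series_def
    by (rule Weierstrass_m_test_general[OF _ summable_on_cmult_right[OF majorant_summable]])
qed

end

section \<open>Short-time Fourier transform and wave front set\<close>

lemma abs_pairing_le: "cmod (\<Sum>i\<in>UNIV. w $ i * of_real (\<xi> $ i)) \<le> wsum w * norm \<xi>"
  unfolding sum_distrib_right
  by (rule sum_norm_le) (auto simp: norm_mult intro!: mult_left_mono component_le_norm_cart)

text \<open>Multiplicativity separates the variables: frequency occurs only in the exponential,
  whose modulus is governed by an imaginary part, and position only in the shifted window, through
  \<open>cshift_translation\<close> at the origin.\<close>

lemma stft_dirac_series: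
  fixes z :: "complex ^ 'd::finite" and \<xi> :: "real ^ 'd"
  assumes \<psi>: "\<psi> \<in> gelfand_shilov s t" and t: "0 < t" "t \<le> 1"
  defines "w \<equiv> imag_shift z" and "c \<equiv> (2 * pi) powr (- real CARD('d) / 2)"
  shows "cmod (stft \<psi> (dirac_series z) x \<xi>) =
    c * exp (- Im (\<Sum>i\<in>UNIV. w $ i * of_real (\<xi> $ i))) * cmod (cshift w \<psi> (- x))"
proof -
  have S: "smooth \<psi>" and E: "entire_at \<psi> y" for y
    using \<psi> gs_smooth entire_type_imp_entire_at gs_entire_type[OF \<psi> t] by blast+
  have T: "smooth (translation x \<psi>)" "entire_at (translation x \<psi>) 0"
    using S E smooth_translation entire_at_translation by blast+
  have m: "modulation \<xi> (translation x \<psi>) = (\<lambda>y. plane_wave \<xi> y * translation x \<psi> y)"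
    unfolding modulation_def ..
  have "dirac_series z (modulation \<xi> (translation x \<psi>)) =
      cnj (cshift w (\<lambda>y. plane_wave \<xi> y * translation x \<psi> y) 0)"
    unfolding m w_def
    by (intro dirac_series_eq_cshift smooth_mult entire_at_mult smooth_plane_wave entire_at_plane_wave T)
  also have "cshift w (\<lambda>y. plane_wave \<xi> y * translation x \<psi> y) 0 =
      exp (\<i> * (\<Sum>i\<in>UNIV. w $ i * of_real (\<xi> $ i))) * cshift w \<psi> (- x)"
    using cshift_mult[OF smooth_plane_wave entire_at_plane_wave T, of w \<xi>] cshift_plane_wave[of w \<xi> 0]
    by (simp add: cshift_translation[OF S])
  finally show ?thesis
    unfolding stft_def c_def by (simp add: norm_mult)
qed

text \<open>The second use of \<open>t \<le> 1\<close>: along the dilations the logarithm of the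
  frequency factor is at most linear in \<open>\<mu>\<close>, for small and large
  \<open>\<mu>\<close> alike.\<close>

lemma powr_le_one_plus: "(\<mu>::real) > 0 \<Longrightarrow> 0 < t \<Longrightarrow> t \<le> 1 \<Longrightarrow> \<mu> powr t \<le> 1 + \<mu>"
proof (cases "\<mu> \<le> 1")
  case True
  assume "\<mu> > 0" "0 < t"
  with True have "\<mu> powr t \<le> 1" by (simp add: powr_le1)
  then show ?thesis using \<open>\<mu> > 0\<close> by simp
next
  case False
  assume "t \<le> 1"
  then have "\<mu> powr t \<le> \<mu> powr 1" using False by (intro powr_mono) auto
  then show ?thesis using False by simp
qed

text \<open>Dilation by \<open>\<mu> powr s\<close> turns decay of order \<open>1/s\<close> in a
  coordinate that stays away from zero into exponential decay in \<open>\<mu>\<close>, at a rate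
  that tends to infinity as \<open>h\<close> tends to 0.\<close>

lemma wave_front_set_outside:
  fixes x0 \<xi>0 :: "real ^ 'd::finite"
  assumes \<psi>: "\<psi> \<in> gelfand_shilov s t" and t: "0 < t" "t \<le> 1" and s: "s > 0" and x0: "x0 \<noteq> 0"
  shows "(x0, \<xi>0) \<notin> wave_front_set s t \<psi> (dirac_series z)"
proof -
  obtain i where i: "x0 $ i \<noteq> 0" using x0 by (auto simp: vec_eq_iff)
  define \<delta> where "\<delta> = \<bar>x0 $ i\<bar> / 2"
  define m where "m = norm \<xi>0 + 1"
  define w where "w = imag_shift z"
  define c where "c = (2 * pi) powr (- real CARD('d) / 2)"
  \<comment> \<open>One set serves all \<open>r\<close>: only a lower bound on one coordinate of
    position and an upper bound on frequency are needed.\<close>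
  define U where "U = {x. \<bar>x $ i\<bar> > \<delta>} \<times> {\<xi> :: real ^ 'd. norm \<xi> < m}"
  have \<delta>: "\<delta> > 0" "\<bar>x0 $ i\<bar> > \<delta>" using i unfolding \<delta>_def by auto
  have W: "wsum w \<ge> 0" by (simp add: sum_nonneg)
  have c: "c \<ge> 0" unfolding c_def by simp
  have "open U" unfolding U_def
    by (intro open_Times open_Collect_less continuous_intros)
  moreover have "U \<subseteq> - {0}" using \<delta>(1) unfolding U_def by (auto simp: zero_prod_def)
  moreover have "(x0, \<xi>0) \<in> U" using \<delta>(2) unfolding U_def m_def by simp
  moreover have "bdd_above {exp (r * \<mu>) * cmod (stft \<psi> (dirac_series z) ((\<mu> powr s) *\<^sub>R x) ((\<mu> powr t) *\<^sub>R \<xi>))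
      | \<mu> x \<xi>. \<mu> > 0 \<and> (x, \<xi>) \<in> U}" if r: "r > 0" for r
  proof -
    \<comment> \<open>The rate to be beaten: \<open>r\<close> comes from the weight and
      \<open>wsum w * m\<close> from the frequency factor.\<close>
    define L where "L = r + wsum w * m"
    have m: "m > 0" unfolding m_def by (simp add: add_nonneg_pos)
    have L: "L > 0" unfolding L_def using r W m by (simp add: add_pos_nonneg)
    \<comment> \<open>This bound on \<open>h\<close> solves
      \<open>s * (\<delta> / h) powr (1/s) / 2 = L\<close>, so any smaller \<open>h\<close> gives a
      decay rate of at least \<open>L\<close>.\<close>
    have "\<delta> / (2 * L / s) powr s > 0" using \<delta> L s by simp
    then obtain h where h: "h > 0" "h \<le> \<delta> / (2 * L / s) powr s" "wsum w * h \<le> 1/2"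
      using small_step[of "\<delta> / (2 * L / s) powr s" "1/2" w] by auto
    have "(2 * L / s) powr s \<le> \<delta> / h"
      using h(1,2) L s by (simp add: field_simps)
    then have "((2 * L / s) powr s) powr (1/s) \<le> (\<delta> / h) powr (1/s)"
      using s by (intro powr_mono2) auto
    then have Lh: "L \<le> s * (\<delta> / h) powr (1/s) / 2"
      using L s by (simp add: powr_powr field_simps)
    define S where "S = 2 powr s * (2 * gs_seminorm s t h \<psi>)"
    have S: "S \<ge> 0" unfolding S_def using gs_seminorm_nonneg[OF \<psi> h(1)] by simp
    have "exp (r * \<mu>) * cmod (stft \<psi> (dirac_series z) ((\<mu> powr s) *\<^sub>R x) ((\<mu> powr t) *\<^sub>R \<xi>))
        \<le> c * (exp (wsum w * m) * S)"
      if \<mu>: "\<mu> > 0" and xU: "(x, \<xi>) \<in> U" for \<mu> x \<xi>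
    proof -
      let ?y = "- ((\<mu> powr s) *\<^sub>R x)"
      let ?E = "- Im (\<Sum>i\<in>UNIV. w $ i * of_real (((\<mu> powr t) *\<^sub>R \<xi>) $ i))"
      have x: "\<bar>x $ i\<bar> > \<delta>" and \<xi>: "norm \<xi> < m" using xU unfolding U_def by auto
      have y: "\<bar>?y $ i\<bar> = \<mu> powr s * \<bar>x $ i\<bar>" by (simp add: abs_mult)
      have y0: "?y $ i \<noteq> 0" using x \<delta>(1) \<mu> by auto
      have "L * \<mu> \<le> s * (\<delta> / h) powr (1/s) / 2 * \<mu>"
        using Lh \<mu> by (intro mult_right_mono) auto
      also have "\<dots> \<le> s * (\<bar>x $ i\<bar> / h) powr (1/s) / 2 * \<mu>"
        using x \<delta>(1) h(1) s \<mu> by (intro mult_right_mono divide_right_mono mult_left_mono powr_mono2) auto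
      also have "\<dots> = s * (\<bar>?y $ i\<bar> / h) powr (1/s) / 2"
      proof -
        have "(\<mu> powr s * (\<bar>x $ i\<bar> / h)) powr (1/s) = \<mu> * (\<bar>x $ i\<bar> / h) powr (1/s)"
          using \<mu> s h(1) powr_mult[of "\<mu> powr s" "\<bar>x $ i\<bar> / h" "1/s"] by (simp add: powr_powr)
        then show ?thesis unfolding y by (simp add: mult_ac)
      qed
      finally have "cmod (cshift w \<psi> ?y) * exp (L * \<mu>) \<le>
          cmod (cshift w \<psi> ?y) * exp (s * (\<bar>?y $ i\<bar> / h) powr (1/s) / 2)"
        by (intro mult_left_mono) auto
      also have "\<dots> \<le> S"
        unfolding S_def by (rule gs_cshift_decay[OF \<psi> t s h(1,3) y0])
      finally have decay: "cmod (cshift w \<psi> ?y) * exp (L * \<mu>) \<le> S" .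
      have "?E \<le> cmod (\<Sum>i\<in>UNIV. w $ i * of_real (((\<mu> powr t) *\<^sub>R \<xi>) $ i))"
        by (rule abs_le_D2[OF abs_Im_le_cmod])
      also have "\<dots> \<le> wsum w * norm ((\<mu> powr t) *\<^sub>R \<xi>)" by (rule abs_pairing_le)
      also have "\<dots> \<le> wsum w * ((1 + \<mu>) * m)"
        using W powr_le_one_plus[OF \<mu> t] \<xi> m \<mu> by (intro mult_left_mono) (auto intro!: mult_mono)
      finally have "r * \<mu> + ?E \<le> wsum w * m + L * \<mu>"
        unfolding L_def by (simp add: algebra_simps)
      then have e: "exp (r * \<mu>) * exp ?E \<le> exp (wsum w * m) * exp (L * \<mu>)"
        unfolding exp_add[symmetric] by simp
      have "exp (r * \<mu>) * cmod (stft \<psi> (dirac_series z) ((\<mu> powr s) *\<^sub>R x) ((\<mu> powr t) *\<^sub>R \<xi>)) =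
          c * (exp (r * \<mu>) * exp ?E * cmod (cshift w \<psi> ?y))"
        unfolding stft_dirac_series[OF \<psi> t] w_def c_def by (simp only: mult_ac)
      also have "\<dots> \<le> c * (exp (wsum w * m) * exp (L * \<mu>) * cmod (cshift w \<psi> ?y))"
        using c e by (intro mult_left_mono mult_right_mono) auto
      also have "\<dots> \<le> c * (exp (wsum w * m) * S)"
        using c decay by (intro mult_left_mono) (auto simp: mult.assoc mult.commute)
      finally show ?thesis .
    qed
    then show ?thesis by (intro bdd_aboveI[where M="c * (exp (wsum w * m) * S)"]) auto
  qed
  ultimately show ?thesis unfolding wave_front_set_def by blast
qed

lemma wave_front_set_inside:
  fixes \<xi>0 :: "real ^ 'd::finite"
  assumes \<psi>: "\<psi> \<in> gelfand_shilov s t" "\<psi> \<noteq> (\<lambda>_. 0)" and t: "0 < t" "t \<le> 1" and s: "s > 0"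
    and \<xi>0: "\<xi>0 \<noteq> 0"
  shows "(0, \<xi>0) \<in> wave_front_set s t \<psi> (dirac_series z)"
proof -
  define w where "w = imag_shift z"
  define c where "c = (2 * pi) powr (- real CARD('d) / 2)"
  have W: "wsum w \<ge> 0" by (simp add: sum_nonneg)
  have c: "c > 0" unfolding c_def by simp
  obtain y where y: "cshift w \<psi> y \<noteq> 0"
    using cshift_inj[OF gs_smooth gs_entire_type[OF _ t]] \<psi> by (metis (no_types, lifting) ext)
  define \<kappa> where "\<kappa> = cmod (cshift w \<psi> y)"
  have \<kappa>: "\<kappa> > 0" unfolding \<kappa>_def using y by simp
  \<comment> \<open>The first summand compensates the strongest possible decay of the frequency
    factor; the 1 leaves a net growth \<open>exp \<mu>\<close>.\<close>
  define r where "r = wsum w * norm \<xi>0 + 1"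
  have r: "r > 0" unfolding r_def using W by (simp add: add_nonneg_pos)
  have False if U: "open U" "(0, \<xi>0) \<in> U" and
    bdd: "bdd_above {exp (r * \<mu>) * cmod (stft \<psi> (dirac_series z) ((\<mu> powr s) *\<^sub>R x) ((\<mu> powr t) *\<^sub>R \<xi>))
      | \<mu> x \<xi>. \<mu> > 0 \<and> (x, \<xi>) \<in> U}" for U
  proof -
    obtain B where B: "\<And>\<mu> x \<xi>. \<mu> > 0 \<Longrightarrow> (x, \<xi>) \<in> U \<Longrightarrow>
        exp (r * \<mu>) * cmod (stft \<psi> (dirac_series z) ((\<mu> powr s) *\<^sub>R x) ((\<mu> powr t) *\<^sub>R \<xi>)) \<le> B"
      using bdd unfolding bdd_above_def by blast
    \<comment> \<open>After dilation the position is \<open>- y\<close> for every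
      \<open>\<mu>\<close>. The minus sign matches the reflected argument of the shifted window,
      whose value keeps the modulus \<open>\<kappa>\<close>.\<close>
    have "((\<lambda>\<mu>. (- (\<mu> powr (- s) *\<^sub>R y), \<xi>0)) \<longlongrightarrow> (- (0 *\<^sub>R y), \<xi>0)) at_top"
      using s by (intro tendsto_intros tendsto_neg_powr filterlim_ident) auto
    then have "((\<lambda>\<mu>. (- (\<mu> powr (- s) *\<^sub>R y), \<xi>0)) \<longlongrightarrow> (0, \<xi>0)) at_top" by simp
    then have "\<forall>\<^sub>F \<mu> in at_top. (- (\<mu> powr (- s) *\<^sub>R y), \<xi>0) \<in> U"
      using U topological_tendstoD by blast
    \<comment> \<open>The threshold beyond which the lower bound for the weighted transform exceeds
      its supposed bound \<open>B\<close>.\<close>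
    moreover have "\<forall>\<^sub>F \<mu>::real in at_top. B * exp (wsum w * norm \<xi>0) / (c * \<kappa>) < exp \<mu>"
      using exp_at_top by (simp add: filterlim_at_top_dense)
    moreover have "\<forall>\<^sub>F \<mu>::real in at_top. \<mu> > 0" by (rule eventually_gt_at_top)
    ultimately have "\<forall>\<^sub>F \<mu>::real in at_top. False"
    proof eventually_elim
      case (elim \<mu>)
      let ?E = "- Im (\<Sum>i\<in>UNIV. w $ i * of_real (((\<mu> powr t) *\<^sub>R \<xi>0) $ i))"
      have "- ?E \<le> cmod (\<Sum>i\<in>UNIV. w $ i * of_real (((\<mu> powr t) *\<^sub>R \<xi>0) $ i))"
        unfolding minus_minus by (rule abs_le_D1[OF abs_Im_le_cmod])
      also have "\<dots> \<le> wsum w * norm ((\<mu> powr t) *\<^sub>R \<xi>0)" by (rule abs_pairing_le)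
      also have "\<dots> \<le> wsum w * ((1 + \<mu>) * norm \<xi>0)"
        using W powr_le_one_plus[OF elim(3) t] elim(3) by (intro mult_left_mono) (auto intro!: mult_mono)
      finally have "\<mu> \<le> wsum w * norm \<xi>0 + (r * \<mu> + ?E)"
        unfolding r_def by (simp add: algebra_simps)
      then have "exp \<mu> \<le> exp (wsum w * norm \<xi>0) * (exp (r * \<mu>) * exp ?E)"
        unfolding exp_add[symmetric] by simp
      then have "exp \<mu> * (c * \<kappa>) \<le> exp (wsum w * norm \<xi>0) * (exp (r * \<mu>) * exp ?E) * (c * \<kappa>)"
        using c \<kappa> by (intro mult_right_mono) auto
      also have "\<dots> = exp (wsum w * norm \<xi>0) *
          (exp (r * \<mu>) * cmod (stft \<psi> (dirac_series z)
            ((\<mu> powr s) *\<^sub>R (- (\<mu> powr (- s) *\<^sub>R y))) ((\<mu> powr t) *\<^sub>R \<xi>0)))"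
      proof -
        have "- ((\<mu> powr s) *\<^sub>R (- (\<mu> powr (- s) *\<^sub>R y))) = y"
          using elim(3) by (simp flip: powr_add)
        then show ?thesis
          unfolding stft_dirac_series[OF \<psi>(1) t] w_def[symmetric] c_def[symmetric] \<kappa>_def
          by (simp only: mult_ac)
      qed
      also have "\<dots> \<le> exp (wsum w * norm \<xi>0) * B"
        using B[OF elim(3,1)] by (intro mult_left_mono) auto
      finally show False using elim(2) c \<kappa> by (simp add: field_simps)
    qed
    then show False by simp
  qed
  moreover have "(0, \<xi>0) \<noteq> 0" using \<xi>0 by (simp add: zero_prod_def)
  ultimately show ?thesis unfolding wave_front_set_def using r by blast
qed

theorem corollary8p2:
  fixes s t :: real and z :: "complex ^ 'd::finite" and u :: "'d functional"
  assumes "0 < t" and "t \<le> 1" and "s > 0" and "s + t > 1"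
    and u_def: "u = (\<lambda>\<phi>. \<Sum>\<^sub>\<infinity>\<alpha>\<in>UNIV. mi_power z \<alpha> / of_real (mi_fact \<alpha>) * neg_D_dist \<alpha> dirac \<phi>)"
  shows "limitin (gs_dual_topology s t)
           (\<lambda>F \<phi>. \<Sum>\<alpha>\<in>F. mi_power z \<alpha> / of_real (mi_fact \<alpha>) * neg_D_dist \<alpha> dirac \<phi>)
           u (finite_subsets_at_top UNIV)
       \<and> u \<in> gs_dual s t
       \<and> (\<forall>\<psi>\<in>gelfand_shilov s t. \<psi> \<noteq> (\<lambda>_. 0) \<longrightarrow>
            wave_front_set s t \<psi> u = {0} \<times> (UNIV - {0}))"
proof (intro conjI ballI impI)
  have u: "u = dirac_series z" unfolding u_def dirac_series_def dirac_term_def ..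
  obtain h where h: "h > 0" "wsum (imag_shift z) * h \<le> 1/2"
    using small_step[of 1 "1/2" "imag_shift z"] by auto
  \<comment> \<open>An infinite sum that fails to converge has a default value, so this limit is
    what certifies \<open>u\<close> as the sum of its series.\<close>
  show "limitin (gs_dual_topology s t)
           (\<lambda>F \<phi>. \<Sum>\<alpha>\<in>F. mi_power z \<alpha> / of_real (mi_fact \<alpha>) * neg_D_dist \<alpha> dirac \<phi>)
           u (finite_subsets_at_top UNIV)"
    using dirac_series_limit[OF assms(1,2) h, of s] unfolding u dirac_term_def .
  show "u \<in> gs_dual s t"
    unfolding u by (rule dirac_series_dual[OF assms(1,2) h])
  fix \<psi> :: "real ^ 'd \<Rightarrow> complex"
  assume \<psi>: "\<psi> \<in> gelfand_shilov s t" "\<psi> \<noteq> (\<lambda>_. 0)"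
  have "(x, \<xi>) \<in> wave_front_set s t \<psi> u \<longleftrightarrow> x = 0 \<and> \<xi> \<noteq> 0" for x \<xi>
  proof (cases "x = 0 \<and> \<xi> \<noteq> 0")
    case True
    then show ?thesis
      using wave_front_set_inside[OF \<psi> assms(1,2,3)] unfolding u by blast
  next
    case False
    moreover have "(0, 0) \<notin> wave_front_set s t \<psi> u"
      unfolding wave_front_set_def by (simp add: zero_prod_def)
    ultimately show ?thesis
      using wave_front_set_outside[OF \<psi>(1) assms(1,2,3)] unfolding u by metis
  qed
  then show "wave_front_set s t \<psi> u = {0} \<times> (UNIV - {0})" by auto
qed

end
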